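(* Let $\mathcal{H}$ be a finite-dimensional complex Hilbert space. Let $\mathbf{C}$ be a conjugation on $L^2(\mathcal{H})$ with $\mathbf{C}\mathbf{M}_z=\mathbf{M}_{\bar z}\mathbf{C}$ and let $\Theta\in L^\infty(L(\mathcal{H}))$ be a pure inner function such that $\Theta(z)$ is $J$-symmetric for almost all $z\in\mathbb{T}$, where $J$ is a conjugation on $\mathcal{H}$. Suppose that $K_\Theta$ is invariant for $\mathbf{C}$. Then $\mathbf{C}=M_{\mathbf{V}}\mathbf{C}_{\Theta,J}$ with $\mathbf{V}$ a unitary valued constant function, $\mathbf{V}(z)=V_0$ a.e. on $\mathbb{T}$, such that $M_{\mathbf{V}}$ is $\mathbf{C}_{\Theta,J}$-symmetric.
   Context: $\mathbb{T}$ is the unit circle with normalized Lebesgue measure, $\mathbb{D}$ the open unit disc. A conjugation on a Hilbert space $\mathcal{K}$ is an antilinear map $C$ with $C^2=I$ and $\langle Cf,Cg\rangle=\langle g,f\rangle$; a bounded linear $A$ is $C$-symmetric if $CAC=A^*$. $L^2(\mathcal{H})$ is the Hilbert space of measurable square-integrable functions $\mathbb{T}\to\mathcal{H}$; $H^2(\mathcal{H})$ is its subspace of functions whose Fourier coefficients of negative index vanish. $L^\infty(L(\mathcal{H}))$ is the space of essentially bounded measurable functions $\mathbb{T}\to L(\mathcal{H})$ ($L(\mathcal{H})$ = bounded linear operators), and $H^\infty(L(\mathcal{H}))$ its subspace of functions $\sum_{n\ge0}F_nz^n$ with vanishing negative Fourier coefficients; each such function is identified with the bounded analytic function $\mathbf{F}(\lambda)=\sum_{n\ge0}F_n\lambda^n$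 on $\mathbb{D}$. For $\mathbf{F}\in L^\infty(L(\mathcal{H}))$, $(M_{\mathbf{F}}\mathbf{f})(z)=\mathbf{F}(z)\mathbf{f}(z)$ a.e.; $(\mathbf{M}_z\mathbf{f})(z)=z\mathbf{f}(z)$, $(\mathbf{M}_{\bar z}\mathbf{f})(z)=\bar z\mathbf{f}(z)$. An inner function is $\Theta\in H^\infty(L(\mathcal{H}))$ with $\Theta(z)$ unitary for almost all $z\in\mathbb{T}$; it is pure if $\|\Theta(0)\|<1$. $K_\Theta=H^2(\mathcal{H})\ominus\Theta H^2(\mathcal{H})$. If $\Theta(z)$ is $J$-symmetric a.e., $\mathbf{C}_{\Theta,J}$ is the conjugation on $L^2(\mathcal{H})$ given by $(\mathbf{C}_{\Theta,J}\mathbf{f})(z)=\Theta(z)\bar zJ(\mathbf{f}(z))$ a.e. on $\mathbb{T}$. *)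

theory Defs
  imports "HOL-Analysis.Analysis"
begin

text \<open>The complex inner product is linear in its first argument. Norm and topology are those of
  the underlying real inner product space, whose inner product is the real part of the complex one;
  in particular the norm of \<open>x\<close> is the square root of \<open>cinner x x\<close>.\<close>

class complex_inner = real_inner +
  fixes scaleC :: "complex \<Rightarrow> 'a \<Rightarrow> 'a"  (infixr "*\<^sub>C" 75)
    and cinner :: "'a \<Rightarrow> 'a \<Rightarrow> complex"
  assumes scaleC_add_right: "a *\<^sub>C (x + y) = a *\<^sub>C x + a *\<^sub>C y"
    and scaleC_add_left: "(a + b) *\<^sub>C x = a *\<^sub>C x + b *\<^sub>C x"
    and scaleC_scaleC: "a *\<^sub>C b *\<^sub>C x = (a * b) *\<^sub>C x"
    and scaleC_of_real: "complex_of_real r *\<^sub>C x = r *\<^sub>R x"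
    and cinner_commute: "cinner x y = cnj (cinner y x)"
    and cinner_add_left: "cinner (x + y) w = cinner x w + cinner y w"
    and cinner_scaleC_left: "cinner (a *\<^sub>C x) y = a * cinner x y"
    and Re_cinner: "Re (cinner x y) = inner x y"

class fd_complex_hilbert = complex_inner +
  assumes finite_dim: "\<exists>B. finite B \<and> (\<forall>x. \<exists>c. x = (\<Sum>b\<in>B. c b *\<^sub>C b))"

text \<open>Completeness and second countability (needed for Bochner integration) follow from finite
  dimension.\<close>

lemma fd_orthogonal_expansion:
  obtains S :: "'a::fd_complex_hilbert set"
  where "finite S" "\<And>x. x = (\<Sum>s\<in>S. (inner x s / inner s s) *\<^sub>R s)"
proof -
  obtain B :: "'a set" where B: "finite B" "\<And>x. \<exists>c. x = (\<Sum>b\<in>B. c b *\<^sub>C b)"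
    using finite_dim by blast
  define T where "T = B \<union> (\<lambda>b. \<i> *\<^sub>C b) ` B"
  have spanT: "x \<in> span T" for x
  proof -
    obtain c where c: "x = (\<Sum>b\<in>B. c b *\<^sub>C b)" using B by blast
    have eq: "c b *\<^sub>C b = Re (c b) *\<^sub>R b + Im (c b) *\<^sub>R (\<i> *\<^sub>C b)" for b
    proof -
      have "c b *\<^sub>C b = (of_real (Re (c b)) + of_real (Im (c b)) * \<i>) *\<^sub>C b"
        by (metis complex_eq mult.commute)
      then show ?thesis by (simp only: scaleC_add_left scaleC_scaleC[symmetric] scaleC_of_real)
    qed
    have "c b *\<^sub>C b \<in> span T" if "b \<in> B" for b
      unfolding eq using that by (intro span_add span_scale span_base) (auto simp: T_def)
    then show ?thesis unfolding c by (intro span_sum)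
  qed
  have "finite T" using B by (simp add: T_def)
  then obtain S where S: "finite S" "span S = span T" "pairwise orthogonal S"
    using basis_orthogonal by metis
  have "x = (\<Sum>s\<in>S. (inner x s / inner s s) *\<^sub>R s)" for x
  proof -
    have "x \<in> span S" using S spanT by blast
    then obtain u where u: "x = (\<Sum>s\<in>S. u s *\<^sub>R s)"
      using span_finite[OF S(1)] by auto
    have "inner x s = u s * inner s s" if "s \<in> S" for s
    proof -
      have "inner x s = (\<Sum>t\<in>S. u t * inner t s)" by (simp add: u inner_sum_left)
      also have "\<dots> = (\<Sum>t\<in>S. if t = s then u s * inner s s else 0)"
        using S(3) that by (intro sum.cong) (auto simp: pairwise_def orthogonal_def)
      finally show ?thesis using S(1) that by simp
    qed
    then have "(\<Sum>s\<in>S. (inner x s / inner s s) *\<^sub>R s) = (\<Sum>s\<in>S. u s *\<^sub>R s)"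
      by (intro sum.cong) auto
    with u show ?thesis by simp
  qed
  with S(1) that show thesis by blast
qed

instance fd_complex_hilbert \<subseteq> banach
proof
  fix X :: "nat \<Rightarrow> 'a" assume X: "Cauchy X"
  obtain S :: "'a set" where S: "finite S" "\<And>x. x = (\<Sum>s\<in>S. (inner x s / inner s s) *\<^sub>R s)"
    using fd_orthogonal_expansion by blast
  have "convergent (\<lambda>n. inner (X n) s)" for s
    using bounded_linear.Cauchy[OF bounded_linear_inner_left X] by (simp add: Cauchy_convergent_iff)
  then have "\<exists>l. (\<lambda>n. inner (X n) s) \<longlonglongrightarrow> l" for s by (simp add: convergent_def)
  then obtain l where l: "\<And>s. (\<lambda>n. inner (X n) s) \<longlonglongrightarrow> l s" by metis
  have "(\<lambda>n. \<Sum>s\<in>S. (inner (X n) s / inner s s) *\<^sub>R s) \<longlonglongrightarrow> (\<Sum>s\<in>S. (l s / inner s s) *\<^sub>R s)"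
    unfolding divide_inverse by (intro tendsto_intros l)
  then show "convergent X" using S(2) by (auto simp: convergent_def)
qed

instance fd_complex_hilbert \<subseteq> second_countable_topology
proof
  obtain S :: "'a set" where S: "finite S" "\<And>x. x = (\<Sum>s\<in>S. (inner x s / inner s s) *\<^sub>R s)"
    using fd_orthogonal_expansion by blast
  define D where "D = (\<lambda>q. \<Sum>s\<in>S. q s *\<^sub>R s) ` (Pi\<^sub>E S (\<lambda>_. \<rat> :: real set))"
  have cD: "countable D" unfolding D_def
    by (intro countable_image countable_PiE S countable_rat)
  have dense: "\<exists>d\<in>D. dist d x < e" if "e > 0" for x :: 'a and e :: real
  proof -
    define c where "c s = inner x s / inner s s" for s
    define K where "K = (\<Sum>s\<in>S. norm s) + 1"
    have K: "K > 0" unfolding K_def by (smt (verit) norm_ge_zero sum_nonneg)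
    have "\<exists>q\<in>\<rat>. \<bar>q - c s\<bar> < e / K" for s
    proof -
      have "c s - e / K < c s + e / K" using K \<open>e > 0\<close> by simp
      from Rats_dense_in_real[OF this] obtain q where "q \<in> \<rat>" "c s - e / K < q" "q < c s + e / K"
        by blast
      then show ?thesis by (intro bexI[of _ q]) auto
    qed
    then obtain q where q: "\<And>s. q s \<in> \<rat>" "\<And>s. \<bar>q s - c s\<bar> < e / K" by metis
    define d where "d = (\<Sum>s\<in>S. restrict q S s *\<^sub>R s)"
    have "d \<in> D" unfolding d_def D_def using q by (intro imageI) auto
    have "d - x = (\<Sum>s\<in>S. (q s - c s) *\<^sub>R s)"
    proof -
      have "x = (\<Sum>s\<in>S. c s *\<^sub>R s)" using S(2)[of x] by (simp add: c_def)
      then show ?thesis by (simp add: d_def sum_subtractf scaleR_left_diff_distrib)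
    qed
    then have "dist d x \<le> (\<Sum>s\<in>S. \<bar>q s - c s\<bar> * norm s)"
      using norm_sum[of "\<lambda>s. (q s - c s) *\<^sub>R s" S] by (simp add: dist_norm)
    also have "\<dots> \<le> (\<Sum>s\<in>S. e / K * norm s)"
      using q(2) by (intro sum_mono mult_right_mono) (auto intro: less_imp_le)
    also have "\<dots> = e / K * (K - 1)" by (subst sum_distrib_left[symmetric]) (simp add: K_def)
    also have "\<dots> < e" using K \<open>e > 0\<close> by (simp add: field_simps)
    finally show ?thesis using \<open>d \<in> D\<close> by blast
  qed
  define \<B> where "\<B> = (\<lambda>(d, n). ball d (1 / Suc n)) ` (D \<times> (UNIV :: nat set))"
  have "countable \<B>" unfolding \<B>_def using cD by (intro countable_image) auto
  moreover have "topological_basis \<B>"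
  proof (rule topological_basisI)
    show "open b" if "b \<in> \<B>" for b using that by (auto simp: \<B>_def)
    fix U :: "'a set" and x assume "open U" "x \<in> U"
    then obtain e where e: "e > 0" "ball x e \<subseteq> U" by (meson openE)
    obtain n where n: "1 / real (Suc n) < e / 2"
      using reals_Archimedean[of "e / 2"] e by (auto simp: inverse_eq_divide)
    obtain d where d: "d \<in> D" "dist d x < 1 / real (Suc n)" using dense[of "1 / real (Suc n)" x] by auto
    have "ball d (1 / Suc n) \<subseteq> ball x e"
    proof
      fix y assume "y \<in> ball d (1 / Suc n)"
      then have "dist x y < 1 / Suc n + 1 / Suc n"
        using d(2) dist_triangle[of x y d] by (simp add: dist_commute)
      with n show "y \<in> ball x e" by simp
    qed
    with d e show "\<exists>b\<in>\<B>. x \<in> b \<and> b \<subseteq> U"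
      by (intro bexI[of _ "ball d (1 / Suc n)"]) (auto simp: \<B>_def)
  qed
  ultimately show "\<exists>B::'a set set. countable B \<and> open = generate_topology B"
    by (meson topological_basis_imp_subbasis)
qed

instantiation complex :: fd_complex_hilbert
begin
definition scaleC_complex :: "complex \<Rightarrow> complex \<Rightarrow> complex" where "scaleC_complex = (*)"
definition cinner_complex :: "complex \<Rightarrow> complex \<Rightarrow> complex" where "cinner_complex x y = x * cnj y"
instance
proof
  show "\<exists>B::complex set. finite B \<and> (\<forall>x. \<exists>c. x = (\<Sum>b\<in>B. c b *\<^sub>C b))"
    by (intro exI[of _ "{1}"]) (auto simp: scaleC_complex_def)
qed (auto simp: scaleC_complex_def cinner_complex_def algebra_simps inner_complex_def scaleR_conv_of_real)
end

definition bounded_clinear :: "('h::complex_inner \<Rightarrow> 'h) \<Rightarrow> bool"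
  where "bounded_clinear A \<longleftrightarrow> bounded_linear A \<and> (\<forall>a x. A (a *\<^sub>C x) = a *\<^sub>C A x)"

definition is_adjoint :: "('h::complex_inner \<Rightarrow> 'h) \<Rightarrow> ('h \<Rightarrow> 'h) \<Rightarrow> bool"
  where "is_adjoint A B \<longleftrightarrow> (\<forall>x y. cinner (A x) y = cinner x (B y))"

definition unitary_op :: "('h::complex_inner \<Rightarrow> 'h) \<Rightarrow> bool"
  where "unitary_op U \<longleftrightarrow> bounded_clinear U \<and> (\<exists>B. is_adjoint U B \<and> B \<circ> U = id \<and> U \<circ> B = id)"

definition conjugation :: "('h::complex_inner \<Rightarrow> 'h) \<Rightarrow> bool"
  where "conjugation C \<longleftrightarrow>
    (\<forall>x y. C (x + y) = C x + C y) \<and> (\<forall>a x. C (a *\<^sub>C x) = cnj a *\<^sub>C C x) \<and>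
    (\<forall>x. C (C x) = x) \<and> (\<forall>x y. cinner (C x) (C y) = cinner y x)"

definition symmetric_op :: "('h::complex_inner \<Rightarrow> 'h) \<Rightarrow> ('h \<Rightarrow> 'h) \<Rightarrow> bool"
  where "symmetric_op C A \<longleftrightarrow> bounded_clinear A \<and> is_adjoint A (C \<circ> A \<circ> C)"

definition circle :: "complex measure"
  where "circle = distr (uniform_measure lborel {0..2 * pi}) (restrict_space borel (sphere 0 1)) cis"

text \<open>Elements of the \<open>L\<^sup>2\<close> and \<open>L\<^sup>\<infinity>\<close> spaces are represented by functions, and equality in these spaces
  is equality almost everywhere on the circle. Values off the circle are irrelevant.\<close>

definition L2 :: "(complex \<Rightarrow> 'h::fd_complex_hilbert) set"
  where "L2 = {f. f \<in> borel_measurable circle \<and> integrable circle (\<lambda>z. (norm (f z))\<^sup>2)}"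

definition l2_eq :: "(complex \<Rightarrow> 'h::fd_complex_hilbert) \<Rightarrow> (complex \<Rightarrow> 'h) \<Rightarrow> bool"
  where "l2_eq f g \<longleftrightarrow> (AE z in circle. f z = g z)"

definition l2_inner :: "(complex \<Rightarrow> 'h::fd_complex_hilbert) \<Rightarrow> (complex \<Rightarrow> 'h) \<Rightarrow> complex"
  where "l2_inner f g = (LINT z|circle. cinner (f z) (g z))"

definition l2_norm :: "(complex \<Rightarrow> 'h::fd_complex_hilbert) \<Rightarrow> real"
  where "l2_norm f = sqrt (LINT z|circle. (norm (f z))\<^sup>2)"

definition fourier_coeff :: "(complex \<Rightarrow> 'h::fd_complex_hilbert) \<Rightarrow> int \<Rightarrow> 'h"
  where "fourier_coeff f n = (LINT z|circle. (z powi (- n)) *\<^sub>C f z)"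

definition H2 :: "(complex \<Rightarrow> 'h::fd_complex_hilbert) set"
  where "H2 = {f \<in> L2. \<forall>n<0. fourier_coeff f n = 0}"

text \<open>A map on \<open>L\<^sup>2\<close> is given by its action on representatives, which has to respect equality almost
  everywhere.\<close>

definition l2_map :: "((complex \<Rightarrow> 'h::fd_complex_hilbert) \<Rightarrow> (complex \<Rightarrow> 'h)) \<Rightarrow> bool"
  where "l2_map A \<longleftrightarrow>
    (\<forall>f\<in>L2. A f \<in> L2) \<and> (\<forall>f\<in>L2. \<forall>g\<in>L2. l2_eq f g \<longrightarrow> l2_eq (A f) (A g))"

definition l2_bounded_clinear :: "((complex \<Rightarrow> 'h::fd_complex_hilbert) \<Rightarrow> (complex \<Rightarrow> 'h)) \<Rightarrow> bool"
  where "l2_bounded_clinear A \<longleftrightarrow> l2_map A \<and>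
    (\<forall>f\<in>L2. \<forall>g\<in>L2. l2_eq (A (\<lambda>z. f z + g z)) (\<lambda>z. A f z + A g z)) \<and>
    (\<forall>a. \<forall>f\<in>L2. l2_eq (A (\<lambda>z. a *\<^sub>C f z)) (\<lambda>z. a *\<^sub>C A f z)) \<and>
    (\<exists>K. \<forall>f\<in>L2. l2_norm (A f) \<le> K * l2_norm f)"

definition l2_conjugation :: "((complex \<Rightarrow> 'h::fd_complex_hilbert) \<Rightarrow> (complex \<Rightarrow> 'h)) \<Rightarrow> bool"
  where "l2_conjugation C \<longleftrightarrow> l2_map C \<and>
    (\<forall>f\<in>L2. \<forall>g\<in>L2. l2_eq (C (\<lambda>z. f z + g z)) (\<lambda>z. C f z + C g z)) \<and>
    (\<forall>a. \<forall>f\<in>L2. l2_eq (C (\<lambda>z. a *\<^sub>C f z)) (\<lambda>z. cnj a *\<^sub>C C f z)) \<and>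
    (\<forall>f\<in>L2. l2_eq (C (C f)) f) \<and>
    (\<forall>f\<in>L2. \<forall>g\<in>L2. l2_inner (C f) (C g) = l2_inner g f)"

text \<open>As in \<open>symmetric_op\<close>, the last conjunct says that \<open>C A C\<close> is the adjoint of \<open>A\<close>.\<close>

definition l2_symmetric :: "((complex \<Rightarrow> 'h::fd_complex_hilbert) \<Rightarrow> (complex \<Rightarrow> 'h)) \<Rightarrow>
    ((complex \<Rightarrow> 'h) \<Rightarrow> (complex \<Rightarrow> 'h)) \<Rightarrow> bool"
  where "l2_symmetric C A \<longleftrightarrow> l2_bounded_clinear A \<and>
    (\<forall>f\<in>L2. \<forall>g\<in>L2. l2_inner (A f) g = l2_inner f (C (A (C g))))"

definition Mz :: "(complex \<Rightarrow> 'h::fd_complex_hilbert) \<Rightarrow> (complex \<Rightarrow> 'h)"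
  where "Mz f = (\<lambda>z. z *\<^sub>C f z)"

definition Mzbar :: "(complex \<Rightarrow> 'h::fd_complex_hilbert) \<Rightarrow> (complex \<Rightarrow> 'h)"
  where "Mzbar f = (\<lambda>z. cnj z *\<^sub>C f z)"

text \<open>Since H is finite-dimensional, measurability in the operator norm is the same as measurability
  of \<open>z \<mapsto> F z x\<close> for all vectors \<open>x\<close>, and operator-valued Fourier coefficients may be computed
  vector by vector.\<close>

definition Linfty :: "(complex \<Rightarrow> 'h::fd_complex_hilbert \<Rightarrow> 'h) set"
  where "Linfty = {F. (\<forall>z\<in>sphere 0 1. bounded_clinear (F z)) \<and>
    (\<forall>x. (\<lambda>z. F z x) \<in> borel_measurable circle) \<and>
    (\<exists>K. AE z in circle. onorm (F z) \<le> K)}"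

definition op_fourier_coeff :: "(complex \<Rightarrow> 'h::fd_complex_hilbert \<Rightarrow> 'h) \<Rightarrow> int \<Rightarrow> ('h \<Rightarrow> 'h)"
  where "op_fourier_coeff F n = (\<lambda>x. fourier_coeff (\<lambda>z. F z x) n)"

definition Hinfty :: "(complex \<Rightarrow> 'h::fd_complex_hilbert \<Rightarrow> 'h) set"
  where "Hinfty = {F \<in> Linfty. \<forall>n<0. op_fourier_coeff F n = (\<lambda>x. 0)}"

definition disc_ext :: "(complex \<Rightarrow> 'h::fd_complex_hilbert \<Rightarrow> 'h) \<Rightarrow> complex \<Rightarrow> ('h \<Rightarrow> 'h)"
  where "disc_ext F w = (\<lambda>x. \<Sum>n. (w ^ n) *\<^sub>C op_fourier_coeff F (int n) x)"

definition mult_op :: "(complex \<Rightarrow> 'h::fd_complex_hilbert \<Rightarrow> 'h) \<Rightarrow>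
    (complex \<Rightarrow> 'h) \<Rightarrow> (complex \<Rightarrow> 'h)"
  where "mult_op F f = (\<lambda>z. F z (f z))"

definition inner_function :: "(complex \<Rightarrow> 'h::fd_complex_hilbert \<Rightarrow> 'h) \<Rightarrow> bool"
  where "inner_function \<Theta> \<longleftrightarrow> \<Theta> \<in> Hinfty \<and> (AE z in circle. unitary_op (\<Theta> z))"

definition pure_function :: "(complex \<Rightarrow> 'h::fd_complex_hilbert \<Rightarrow> 'h) \<Rightarrow> bool"
  where "pure_function \<Theta> \<longleftrightarrow> onorm (disc_ext \<Theta> 0) < 1"

definition model_space :: "(complex \<Rightarrow> 'h::fd_complex_hilbert \<Rightarrow> 'h) \<Rightarrow> (complex \<Rightarrow> 'h) set"
  where "model_space \<Theta> = {f \<in> H2. \<forall>g\<in>H2. l2_inner f (mult_op \<Theta> g) = 0}"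

definition model_conj :: "(complex \<Rightarrow> 'h::fd_complex_hilbert \<Rightarrow> 'h) \<Rightarrow> ('h \<Rightarrow> 'h) \<Rightarrow>
    (complex \<Rightarrow> 'h) \<Rightarrow> (complex \<Rightarrow> 'h)"
  where "model_conj \<Theta> J f = (\<lambda>z. \<Theta> z (cnj z *\<^sub>C J (f z)))"

end

theory Submission
  imports Defs
begin

text \<open>Write \<open>S\<close> for the conjugation \<open>f \<mapsto> \<Theta> \<cdot> cnj z \<cdot> J f\<close> attached to \<open>\<Theta>\<close>. Both \<open>C\<close> and \<open>S\<close> turn
  multiplication by \<open>z\<close> into multiplication by \<open>cnj z\<close>, and both leave the model space \<open>K\<close> of \<open>\<Theta>\<close>
  invariant (for \<open>S\<close> this is lemma \<open>model_conj_model_space\<close>). Hence \<open>D = C \<circ> S\<close> and \<open>E = S \<circ> C\<close> are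
  mutually inverse, adjoint to each other, commute with multiplication by \<open>z\<close>, and leave \<open>K\<close> invariant.
  Since \<open>C = D \<circ> S\<close>, the theorem says that \<open>D\<close> is multiplication by a constant unitary operator.

  The central step (\<open>const_to_H2\<close>) is that such a \<open>D\<close> maps constants into \<open>H\<^sup>2\<close>. The space \<open>K\<close> contains
  the functions \<open>(1 - T) x\<close> with \<open>x\<close> constant and \<open>T = \<Theta> \<Theta>(0)\<^sup>*\<close> (\<open>kernel_in_model_space\<close>). So \<open>D\<close> maps
  \<open>z\<^sup>m (1 - T) x\<close> into \<open>H\<^sup>2\<close> for all \<open>m \<ge> 0\<close>, and if \<open>u\<close> is the image under \<open>E\<close> of a function
  \<open>z\<^sup>n y\<close> with \<open>n < 0\<close>, then \<open>u\<close> is orthogonal to \<open>(1 - T) H\<^sup>2\<close>. This means \<open>\<langle>g, u\<rangle> = \<langle>T g, u\<rangle>\<close> for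
  \<open>g\<close> in \<open>H\<^sup>2\<close>, and therefore \<open>\<langle>x, u\<rangle> = \<langle>T\<^sup>k x, u\<rangle>\<close> for all \<open>k\<close>. As \<open>\<Theta>(z)\<close> is unitary and \<open>\<Theta>\<close> is pure,
  \<open>T\<close> shrinks norms by a factor below 1, so \<open>\<langle>x, u\<rangle> = 0\<close>, which is the vanishing of the negative
  Fourier coefficients of \<open>D x\<close>.

  The same holds for \<open>E\<close>. The positive Fourier coefficients of \<open>D x\<close> are conjugates of negative ones of
  \<open>E y\<close>, so \<open>D x\<close> is constant (\<open>const_to_const\<close>), and because \<open>D\<close> commutes with multiplication by \<open>z\<close>,
  it acts on all of \<open>L\<^sup>2\<close> through its action on constants (\<open>eq_mult_const_symbol\<close>).

  The analytic input is the density of trigonometric polynomials in \<open>L\<^sup>2\<close> (\<open>trig_approximable_L2\<close>). It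
  is used in two forms: a function is determined by its Fourier coefficients (\<open>L2_eq_if_inner_eq\<close>),
  and a function with no coefficients of index \<open>\<ge> 0\<close> is orthogonal to \<open>H\<^sup>2\<close> (\<open>H2_orthogonal\<close>).\<close>

section \<open>Complex inner product spaces\<close>

lemma cinner_add_right: "cinner x (y + w) = cinner x y + cinner x w"
  for x y w :: "'a::complex_inner"
  by (metis cinner_add_left cinner_commute complex_cnj_add)

lemma cinner_scaleC_right: "cinner x (a *\<^sub>C y) = cnj a * cinner x y"
  for x y :: "'a::complex_inner"
  by (metis cinner_commute cinner_scaleC_left complex_cnj_mult)

lemma scaleC_one [simp]: "1 *\<^sub>C x = x" for x :: "'a::complex_inner"
  using scaleC_of_real[of 1 x] by simp

lemma scaleC_zero_left [simp]: "0 *\<^sub>C x = 0" for x :: "'a::complex_inner"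
  using scaleC_of_real[of 0 x] by simp

lemma scaleC_zero_right [simp]: "a *\<^sub>C 0 = 0" for a :: complex
  using scaleC_add_right[of a 0 0] by simp

lemma cinner_zero_left [simp]: "cinner 0 x = 0" for x :: "'a::complex_inner"
  using cinner_scaleC_left[of 0 0 x] by simp

lemma cinner_zero_right [simp]: "cinner x 0 = 0" for x :: "'a::complex_inner"
  using cinner_scaleC_right[of x 0 0] by simp

lemma cinner_diff_left: "cinner (x - y) w = cinner x w - cinner y w"
  for x y w :: "'a::complex_inner"
  using cinner_add_left[of "x - y" y w] by simp

lemma cinner_diff_right: "cinner x (y - w) = cinner x y - cinner x w"
  for x y w :: "'a::complex_inner"
  using cinner_add_right[of x "y - w" w] by simp

lemma cinner_self: "cinner x x = of_real ((norm x)\<^sup>2)" for x :: "'a::complex_inner"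
proof -
  have "Im (cinner x x) = 0" using cinner_commute[of x x] by (simp add: complex_eq_iff)
  then show ?thesis by (simp add: complex_eq_iff Re_cinner power2_norm_eq_inner)
qed

lemma cinner_ext: "(\<And>y. cinner x y = cinner x' y) \<Longrightarrow> x = x'" for x x' :: "'a::complex_inner"
proof -
  assume "\<And>y. cinner x y = cinner x' y"
  then have "cinner (x - x') (x - x') = 0" by (simp add: cinner_diff_left)
  then show ?thesis by (simp add: cinner_self)
qed

lemma norm_eq_of_cinner_self_eq: "cinner x x = cinner y y \<Longrightarrow> norm x = norm y"
  for x y :: "'a::complex_inner"
  unfolding cinner_self of_real_eq_iff by simp

lemma norm_scaleC: "norm (a *\<^sub>C x) = cmod a * norm x" for x :: "'a::complex_inner"
proof -
  have "cinner (a *\<^sub>C x) (a *\<^sub>C x) = of_real ((cmod a * norm x)\<^sup>2)"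
    unfolding cinner_scaleC_left cinner_scaleC_right
    using complex_norm_square[of a]
    by (simp add: cinner_self power_mult_distrib mult.commute mult.left_commute)
  then have "(norm (a *\<^sub>C x))\<^sup>2 = (cmod a * norm x)\<^sup>2"
    unfolding cinner_self of_real_eq_iff .
  then show ?thesis by simp
qed

lemma norm_cinner_le: "cmod (cinner x y) \<le> norm x * norm y" for x y :: "'a::complex_inner"
proof (cases "cinner x y = 0")
  case False
  \<comment> \<open>Rotating \<open>x\<close> makes the complex inner product a nonnegative real, hence equal to the real one.\<close>
  define a where "a = cnj (sgn (cinner x y))"
  have a: "cmod a = 1" using False by (simp add: a_def norm_sgn)
  have "cinner (a *\<^sub>C x) y = of_real (cmod (cinner x y))"
    using False by (simp add: a_def cinner_scaleC_left sgn_eq field_simps complex_norm_square[symmetric]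
        power2_eq_square)
  then have "cmod (cinner x y) = inner (a *\<^sub>C x) y" by (metis Re_cinner Re_complex_of_real)
  also have "\<dots> \<le> norm (a *\<^sub>C x) * norm y" by (rule norm_cauchy_schwarz)
  finally show ?thesis by (simp add: norm_scaleC a)
qed simp

lemma bounded_bilinear_cinner: "bounded_bilinear (cinner :: 'a::complex_inner \<Rightarrow> 'a \<Rightarrow> complex)"
proof
  fix r :: real and a b :: 'a
  show "cinner (r *\<^sub>R a) b = r *\<^sub>R cinner a b"
    by (simp add: cinner_scaleC_left scaleR_conv_of_real flip: scaleC_of_real)
  show "cinner a (r *\<^sub>R b) = r *\<^sub>R cinner a b"
    by (simp add: cinner_scaleC_right scaleR_conv_of_real flip: scaleC_of_real)
  show "\<exists>K. \<forall>a b :: 'a. norm (cinner a b) \<le> norm a * norm b * K"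
    by (intro exI[of _ 1]) (simp add: norm_cinner_le)
qed (simp_all add: cinner_add_left cinner_add_right)

lemma bounded_bilinear_scaleC: "bounded_bilinear ((*\<^sub>C) :: complex \<Rightarrow> 'a \<Rightarrow> 'a::complex_inner)"
proof
  fix r :: real and a :: complex and b :: 'a
  show "(r *\<^sub>R a) *\<^sub>C b = r *\<^sub>R (a *\<^sub>C b)"
    by (simp add: scaleR_conv_of_real scaleC_scaleC flip: scaleC_of_real)
  show "a *\<^sub>C (r *\<^sub>R b) = r *\<^sub>R (a *\<^sub>C b)"
    by (simp add: scaleC_scaleC mult.commute flip: scaleC_of_real)
  show "\<exists>K. \<forall>a (b :: 'a). norm (a *\<^sub>C b) \<le> norm a * norm b * K"
    by (intro exI[of _ 1]) (simp add: norm_scaleC)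
qed (simp_all add: scaleC_add_left scaleC_add_right)

lemma scaleC_diff_right: "a *\<^sub>C (x - y) = a *\<^sub>C x - a *\<^sub>C y" for x y :: "'a::complex_inner"
  using scaleC_add_right[of a "x - y" y] by simp

lemma norm_add_square_le: "(norm (x + y))\<^sup>2 \<le> 2 * (norm x)\<^sup>2 + 2 * (norm y)\<^sup>2"
  for x y :: "'a::real_normed_vector"
proof -
  have "(norm (x + y))\<^sup>2 \<le> (norm x + norm y)\<^sup>2" by (simp add: norm_triangle_ineq power_mono)
  also have "\<dots> \<le> 2 * (norm x)\<^sup>2 + 2 * (norm y)\<^sup>2"
    using sum_squares_ge_zero[of "norm x - norm y" 0] by (simp add: power2_eq_square algebra_simps)
  finally show ?thesis .
qed

lemma norm_diff_square:
  "(norm (x - y))\<^sup>2 = (norm x)\<^sup>2 + (norm y)\<^sup>2 - 2 * Re (cinner x y)" for x y :: "'a::complex_inner"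
  by (simp add: Re_cinner power2_norm_eq_inner inner_diff inner_commute)

text \<open>Expanding the argument in a finite orthogonal family writes \<open>A\<close> as a finite sum of bounded maps.\<close>

lemma bounded_linear_fd:
  fixes A :: "'a::fd_complex_hilbert \<Rightarrow> 'b::real_normed_vector"
  assumes "linear A"
  shows "bounded_linear A"
proof -
  obtain S :: "'a set" where S: "finite S" "\<And>x. x = (\<Sum>s\<in>S. (inner x s / inner s s) *\<^sub>R s)"
    using fd_orthogonal_expansion by blast
  have A: "A = (\<lambda>x. \<Sum>s\<in>S. (inner x s / inner s s) *\<^sub>R A s)"
  proof
    fix x
    have "A x = A (\<Sum>s\<in>S. (inner x s / inner s s) *\<^sub>R s)" using S(2)[of x] by (rule arg_cong)
    then show "A x = (\<Sum>s\<in>S. (inner x s / inner s s) *\<^sub>R A s)"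
      by (simp only: linear_sum[OF assms] linear_scale[OF assms])
  qed
  show ?thesis
    by (subst A) (intro bounded_linear_sum bounded_linear_scaleR_const
        bounded_linear_compose[OF bounded_linear_divide bounded_linear_inner_left])
qed

lemma conjugation_norm: "conjugation J \<Longrightarrow> norm (J x) = norm x"
  by (intro norm_eq_of_cinner_self_eq) (simp add: conjugation_def)

lemma conjugation_involution: "conjugation J \<Longrightarrow> J (J x) = x"
  by (simp add: conjugation_def)

lemma conjugation_scaleC: "conjugation J \<Longrightarrow> J (a *\<^sub>C x) = cnj a *\<^sub>C J x"
  by (simp add: conjugation_def)

lemma conjugation_bounded_linear:
  assumes "conjugation J"
  shows "bounded_linear J"
proof (rule bounded_linear_intro[where K = 1])
  show "J (x + y) = J x + J y" for x y using assms by (simp add: conjugation_def)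
  show "J (r *\<^sub>R x) = r *\<^sub>R J x" for r x
    using conjugation_scaleC[OF assms, of "of_real r" x] by (simp add: scaleC_of_real)
qed (simp add: conjugation_norm assms)

lemma unitary_op_isometric:
  assumes "unitary_op U"
  shows "cinner (U x) (U y) = cinner x y"
proof -
  obtain B where "is_adjoint U B" "B \<circ> U = id" using assms by (auto simp: unitary_op_def)
  then show ?thesis by (metis comp_apply eq_id_iff is_adjoint_def)
qed

lemma unitary_op_norm: "unitary_op U \<Longrightarrow> norm (U x) = norm x"
  by (intro norm_eq_of_cinner_self_eq unitary_op_isometric)

text \<open>A \<open>J\<close>-symmetric operator has the adjoint \<open>J U J\<close>, which for unitary \<open>U\<close> is also its inverse.\<close>

lemma unitary_symmetric_involution:
  assumes "unitary_op U" "symmetric_op J U" "conjugation J"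
  shows "U (J (U (J x))) = x"
proof -
  obtain B where B: "is_adjoint U B" "U \<circ> B = id" using assms by (auto simp: unitary_op_def)
  have "cinner y (J (U (J x))) = cinner y (B x)" for y
    using assms(2) B(1) by (metis comp_apply is_adjoint_def symmetric_op_def)
  then have "J (U (J x)) = B x" by (metis cinner_commute cinner_ext)
  then show ?thesis using B(2) by (metis comp_apply id_apply)
qed

section \<open>Integration over the circle\<close>

lemma space_circle [simp]: "space circle = sphere 0 1"
  by (simp add: circle_def space_restrict_space)

lemma sets_circle: "sets circle = sets (restrict_space borel (sphere 0 1))"
  by (simp add: circle_def)

lemma measurable_cis [measurable]:
  "cis \<in> measurable (uniform_measure lborel {0..2 * pi}) (restrict_space borel (sphere 0 1))"
  by (intro measurable_restrict_space2)
    (auto simp: cong: measurable_cong_sets intro!: borel_measurable_continuous_onI continuous_intros)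

lemma emeasure_space_circle: "emeasure circle (space circle) = 1"
proof -
  have "emeasure (uniform_measure lborel {0..2 * pi}) UNIV = 1"
    by (subst emeasure_uniform_measure) (auto simp: divide_eq_1_ennreal)
  moreover have "cis -` sphere 0 1 = UNIV" by auto
  moreover have "sphere 0 1 \<in> sets (restrict_space borel (sphere (0::complex) 1))"
    using sets.top[of "restrict_space borel (sphere (0::complex) 1)"] by (simp add: space_restrict_space)
  ultimately show ?thesis
    using emeasure_distr[OF measurable_cis, of "sphere 0 1"]
    by (simp add: circle_def[symmetric])
qed

interpretation circle: finite_measure circle
  by (rule finite_measureI) (simp only: emeasure_space_circle, simp)

lemma measure_circle [simp]: "measure circle (sphere 0 1) = 1"
  using emeasure_space_circle by (simp add: measure_def)

lemma borel_measurable_circle_continuous: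
  "continuous_on (sphere 0 1) f \<Longrightarrow> f \<in> borel_measurable circle"
  by (simp add: sets_circle borel_measurable_continuous_on_restrict cong: measurable_cong_sets)

lemma AE_circle_sphere: "AE z in circle. norm z = 1"
  by (rule AE_I2) simp

lemma continuous_on_powi: "continuous_on (sphere 0 1) (\<lambda>z::complex. z powi n)"
  by (intro continuous_intros) auto

lemma borel_measurable_powi [measurable]: "(\<lambda>z::complex. z powi n) \<in> borel_measurable circle"
  by (intro borel_measurable_circle_continuous continuous_on_powi)

lemma cnj_powi_unit: "norm z = 1 \<Longrightarrow> cnj (z powi n) = z powi (- n)" for z :: complex
proof -
  assume "norm z = 1"
  then have "cnj z = inverse z" 
    using complex_norm_square[of z] by (intro inverse_unique[symmetric]) simp
  then show ?thesis by (simp only: complex_cnj_power_int power_int_minus power_int_inverse)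
qed

text \<open>The pullback of \<open>z\<^sup>n\<close> to the interval has the \<open>2 \<pi>\<close>-periodic primitive \<open>cis (n t) / (\<i> n)\<close>.\<close>

lemma integral_powi_circle:
  assumes "n \<noteq> 0"
  shows "(LINT z|circle. z powi n) = 0"
proof -
  define c where "c = 1 / (2 * pi)"
  have um: "uniform_measure lborel {0..2 * pi} = density lborel (\<lambda>t. ennreal (c * indicator {0..2*pi} t))"
    unfolding uniform_measure_def
    by (intro density_cong) (auto simp: c_def divide_ennreal[symmetric] indicator_def ennreal_1[symmetric] simp del: ennreal_1)
  have cis_powi: "cis t powi n = cis (of_int n * t)" for t by (simp add: cis_power_int)
  have "(LINT z|circle. z powi n) = (LINT t|uniform_measure lborel {0..2*pi}. cis (of_int n * t))"
    unfolding circle_def cis_powi[symmetric]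
    by (rule integral_distr[OF measurable_cis])
      (intro borel_measurable_continuous_on_restrict continuous_on_powi)
  also have "\<dots> = (LINT t|lborel. (c * indicator {0..2*pi} t) *\<^sub>R cis (of_int n * t))"
    unfolding um
    by (rule integral_density) (auto simp: c_def intro!: borel_measurable_continuous_onI continuous_intros)
  also have "\<dots> = c *\<^sub>R (LINT t|lborel. indicator {0..2*pi} t *\<^sub>R cis (of_int n * t))"
    by (simp flip: integral_scaleR_right)
  also have "(LINT t|lborel. indicator {0..2*pi} t *\<^sub>R cis (of_int n * t))
      = cis (of_int n * (2 * pi)) / (\<i> * of_int n) - cis (of_int n * 0) / (\<i> * of_int n)"
  proof (rule integral_FTC_atLeastAtMost)
    fix t :: real
    have "((\<lambda>w. exp (\<i> * of_int n * w) / (\<i> * of_int n)) has_field_derivative exp (\<i> * of_int n * of_real t))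
        (at (of_real t))"
      using assms by (auto intro!: derivative_eq_intros)
    from has_vector_derivative_real_field[OF this, of "{0..2 * pi}"]
    show "((\<lambda>t. cis (of_int n * t) / (\<i> * of_int n)) has_vector_derivative cis (of_int n * t))
        (at t within {0..2 * pi})"
      by (simp add: cis_conv_exp mult.assoc)
  qed (auto intro!: continuous_intros)
  also have "cis (of_int n * (2 * pi)) = 1" using cis_multiple_2pi[of "of_int n"] by (simp add: mult_ac)
  finally show ?thesis by simp
qed

section \<open>The spaces \<open>L\<^sup>2\<close> and \<open>H\<^sup>2\<close>\<close>

lemma borel_measurable_scaleC [measurable]:
  fixes f :: "'a \<Rightarrow> complex" and g :: "'a \<Rightarrow> 'h::fd_complex_hilbert"
  assumes "f \<in> borel_measurable M" "g \<in> borel_measurable M"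
  shows "(\<lambda>z. f z *\<^sub>C g z) \<in> borel_measurable M"
  using assms
  by (rule borel_measurable_continuous_Pair)
    (intro bounded_bilinear.continuous_on[OF bounded_bilinear_scaleC] continuous_intros)

lemma borel_measurable_cinner [measurable]:
  fixes f g :: "'a \<Rightarrow> 'h::fd_complex_hilbert"
  assumes "f \<in> borel_measurable M" "g \<in> borel_measurable M"
  shows "(\<lambda>z. cinner (f z) (g z)) \<in> borel_measurable M"
  using assms
  by (rule borel_measurable_continuous_Pair)
    (intro bounded_bilinear.continuous_on[OF bounded_bilinear_cinner] continuous_intros)

lemma L2_measurable [measurable_dest]: "f \<in> L2 \<Longrightarrow> f \<in> borel_measurable circle"
  by (simp add: L2_def)

lemma L2_integrable: "f \<in> L2 \<Longrightarrow> integrable circle (\<lambda>z. (norm (f z))\<^sup>2)"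
  by (simp add: L2_def)

lemma L2_dominated:
  assumes [measurable]: "f \<in> borel_measurable circle" and "g \<in> L2"
    and "AE z in circle. norm (f z) \<le> K * norm (g z)"
  shows "f \<in> L2"
proof -
  have "integrable circle (\<lambda>z. (norm (f z))\<^sup>2)"
  proof (rule Bochner_Integration.integrable_bound)
    show "integrable circle (\<lambda>z. K\<^sup>2 * (norm (g z))\<^sup>2)" using L2_integrable[OF assms(2)] by simp
    show "AE z in circle. norm ((norm (f z))\<^sup>2) \<le> norm (K\<^sup>2 * (norm (g z))\<^sup>2)"
      using assms(3)
    proof eventually_elim
      fix z assume "norm (f z) \<le> K * norm (g z)"
      then have "(norm (f z))\<^sup>2 \<le> (K * norm (g z))\<^sup>2" by (intro power_mono) auto
      then show "norm ((norm (f z))\<^sup>2) \<le> norm (K\<^sup>2 * (norm (g z))\<^sup>2)"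
        by (simp add: power_mult_distrib)
    qed
  qed simp
  then show ?thesis by (simp add: L2_def)
qed

lemma L2_bounded:
  assumes [measurable]: "f \<in> borel_measurable circle"
    and "\<And>z. norm z = 1 \<Longrightarrow> norm (f z) \<le> K"
  shows "f \<in> L2"
proof -
  have "(norm (f z))\<^sup>2 \<le> K\<^sup>2" if "norm z = 1" for z
    using assms(2)[OF that] by (intro power_mono) auto
  then have "integrable circle (\<lambda>z. (norm (f z))\<^sup>2)"
    by (intro circle.integrable_const_bound[where B = "K\<^sup>2"]) (auto intro!: AE_I2)
  then show ?thesis by (simp add: L2_def)
qed

lemma L2_add: "f \<in> L2 \<Longrightarrow> g \<in> L2 \<Longrightarrow> (\<lambda>z. f z + g z) \<in> L2"
proof -
  assume fg: "f \<in> L2" "g \<in> L2"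
  then have [measurable]: "f \<in> borel_measurable circle" "g \<in> borel_measurable circle"
    by (auto simp: L2_def)
  have "integrable circle (\<lambda>z. 2 * (norm (f z))\<^sup>2 + 2 * (norm (g z))\<^sup>2)"
    using L2_integrable[OF fg(1)] L2_integrable[OF fg(2)] by simp
  then have "integrable circle (\<lambda>z. (norm (f z + g z))\<^sup>2)"
    by (rule Bochner_Integration.integrable_bound) (simp_all add: norm_add_square_le)
  then show ?thesis by (simp add: L2_def)
qed

lemma L2_powi: "f \<in> L2 \<Longrightarrow> (\<lambda>z. z powi n *\<^sub>C f z) \<in> L2"
  by (rule L2_dominated[where g = f and K = 1])
    (auto simp: norm_scaleC norm_power_int intro!: AE_I2)

lemma L2_linear:
  assumes "bounded_linear A" "f \<in> L2"
  shows "(\<lambda>z. A (f z)) \<in> L2"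
proof (rule L2_dominated[OF _ assms(2), where K = "onorm A"])
  show "(\<lambda>z. A (f z)) \<in> borel_measurable circle"
    using borel_measurable_continuous_onI[OF linear_continuous_on[OF assms(1)]] assms(2)
    by (metis L2_measurable measurable_compose)
  show "AE z in circle. norm (A (f z)) \<le> onorm A * norm (f z)"
    by (simp add: onorm assms(1))
qed

lemma L2_diff: "f \<in> L2 \<Longrightarrow> g \<in> L2 \<Longrightarrow> (\<lambda>z. f z - g z) \<in> L2"
  using L2_add[of f "\<lambda>z. - g z"] L2_linear[OF bounded_linear_minus[OF bounded_linear_ident], of g] by simp

definition monomial :: "int \<Rightarrow> 'h \<Rightarrow> complex \<Rightarrow> 'h::fd_complex_hilbert"
  where "monomial n y = (\<lambda>z. z powi n *\<^sub>C y)"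

lemma L2_const: "(\<lambda>z. y) \<in> L2"
  by (rule L2_bounded[where K = "norm y"]) auto

lemma L2_monomial [simp]: "monomial n y \<in> L2"
  unfolding monomial_def by (rule L2_powi[OF L2_const])

lemma monomial_0: "monomial 0 y = (\<lambda>z. y)"
  by (simp add: monomial_def)

lemma L2_integrable_cinner:
  assumes "f \<in> L2" "g \<in> L2"
  shows "integrable circle (\<lambda>z. cinner (f z) (g z))"
proof (rule Bochner_Integration.integrable_bound)
  show "integrable circle (\<lambda>z. (norm (f z))\<^sup>2 + (norm (g z))\<^sup>2)"
    using L2_integrable[OF assms(1)] L2_integrable[OF assms(2)] by simp
  have "cmod (cinner x y) \<le> (norm x)\<^sup>2 + (norm y)\<^sup>2" for x y :: 'a
    using norm_cinner_le[of x y] sum_squares_bound[of "norm x" "norm y"]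
      mult_nonneg_nonneg[OF norm_ge_zero[of x] norm_ge_zero[of y]]
    by linarith
  then show "AE z in circle. norm (cinner (f z) (g z)) \<le> norm ((norm (f z))\<^sup>2 + (norm (g z))\<^sup>2)"
    by simp
qed (use assms in measurable)

lemma L2_integrable_self:
  assumes "f \<in> L2"
  shows "integrable circle f"
proof (rule Bochner_Integration.integrable_bound)
  show "integrable circle (\<lambda>z. 1 + (norm (f z))\<^sup>2)" using L2_integrable[OF assms] by simp
  have "norm x \<le> norm (1 + (norm x)\<^sup>2)" for x :: 'a
    using sum_squares_bound[of 1 "norm x"] norm_ge_zero[of x]
    by (simp only: power_one mult_1_right real_norm_def)
  then show "AE z in circle. norm (f z) \<le> norm (1 + (norm (f z))\<^sup>2)" by (intro AE_I2)
qed (rule L2_measurable[OF assms])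

lemma l2_inner_commute: "l2_inner f g = cnj (l2_inner g f)"
proof -
  have "l2_inner f g = (LINT z|circle. cnj (cinner (g z) (f z)))"
    unfolding l2_inner_def by (intro Bochner_Integration.integral_cong refl cinner_commute)
  then show ?thesis by (simp add: l2_inner_def)
qed

lemma l2_inner_add_left:
  "f \<in> L2 \<Longrightarrow> g \<in> L2 \<Longrightarrow> h \<in> L2 \<Longrightarrow> l2_inner (\<lambda>z. f z + g z) h = l2_inner f h + l2_inner g h"
  by (simp add: l2_inner_def cinner_add_left L2_integrable_cinner)

lemma l2_inner_diff_left:
  "f \<in> L2 \<Longrightarrow> g \<in> L2 \<Longrightarrow> h \<in> L2 \<Longrightarrow> l2_inner (\<lambda>z. f z - g z) h = l2_inner f h - l2_inner g h"
  by (simp add: l2_inner_def cinner_diff_left L2_integrable_cinner)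

lemma l2_inner_diff_right:
  "f \<in> L2 \<Longrightarrow> g \<in> L2 \<Longrightarrow> h \<in> L2 \<Longrightarrow> l2_inner h (\<lambda>z. f z - g z) = l2_inner h f - l2_inner h g"
  by (simp add: l2_inner_def cinner_diff_right L2_integrable_cinner)

lemma l2_inner_add_right:
  "f \<in> L2 \<Longrightarrow> g \<in> L2 \<Longrightarrow> h \<in> L2 \<Longrightarrow> l2_inner h (\<lambda>z. f z + g z) = l2_inner h f + l2_inner h g"
  by (simp add: l2_inner_def cinner_add_right L2_integrable_cinner)

lemma l2_inner_cong:
  assumes "AE z in circle. cinner (f z) (g z) = cinner (f' z) (g' z)"
    and [measurable]: "f \<in> borel_measurable circle" "g \<in> borel_measurable circle"
      "f' \<in> borel_measurable circle" "g' \<in> borel_measurable circle"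
  shows "l2_inner f g = l2_inner f' g'"
  unfolding l2_inner_def by (rule integral_cong_AE) (use assms(1) in auto)

lemma l2_inner_powi:
  "l2_inner (\<lambda>z. z powi n *\<^sub>C f z) g = l2_inner f (\<lambda>z. z powi (- n) *\<^sub>C g z)"
  unfolding l2_inner_def
  by (intro Bochner_Integration.integral_cong)
    (auto simp: cinner_scaleC_left cinner_scaleC_right cnj_powi_unit simp del: complex_cnj_power_int)

lemma powi_add_unit: "norm z = 1 \<Longrightarrow> z powi (m + n) = z powi m * z powi n" for z :: complex
  by (rule power_int_add) auto

lemma powi_monomial: "norm z = 1 \<Longrightarrow> z powi m *\<^sub>C monomial n y z = monomial (m + n) y z"
  by (simp add: monomial_def scaleC_scaleC powi_add_unit)

lemma l2_inner_powi_monomial: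
  "l2_inner (\<lambda>z. z powi m *\<^sub>C f z) (monomial n y) = l2_inner f (monomial (n - m) y)"
  unfolding l2_inner_powi
  by (auto simp: l2_inner_def powi_monomial intro!: Bochner_Integration.integral_cong)

lemma l2_inner_monomials:
  "l2_inner (monomial m x) (monomial n y) = (if m = n then cinner x y else 0)"
proof -
  have "l2_inner (monomial m x) (monomial n y) = (LINT z|circle. z powi (m - n) * cinner x y)"
    unfolding l2_inner_def
  proof (intro Bochner_Integration.integral_cong refl)
    fix z :: complex assume "z \<in> space circle"
    then have "cmod z = 1" by simp
    then show "cinner (monomial m x z) (monomial n y z) = z powi (m - n) * cinner x y"
      using powi_add_unit[of z m "- n"] cnj_powi_unit[of z n]
      by (simp add: monomial_def cinner_scaleC_left cinner_scaleC_right del: complex_cnj_power_int)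
  qed
  then show ?thesis by (simp add: integral_powi_circle)
qed

text \<open>This turns vector-valued Fourier coefficients into scalar products with monomials, so that adjoint
  operators can be moved across them.\<close>

lemma cinner_fourier_coeff:
  assumes "f \<in> L2"
  shows "cinner (fourier_coeff f n) y = l2_inner f (monomial n y)"
proof -
  have "cinner (fourier_coeff f n) y = (LINT z|circle. cinner (z powi (- n) *\<^sub>C f z) y)"
    unfolding fourier_coeff_def
    by (rule integral_bounded_linear[symmetric,
          OF bounded_bilinear.bounded_linear_left[OF bounded_bilinear_cinner]
            L2_integrable_self[OF L2_powi[OF assms]]])
  also have "\<dots> = l2_inner (\<lambda>z. z powi (- n) *\<^sub>C f z) (monomial 0 y)"
    by (simp add: l2_inner_def monomial_0)
  finally show ?thesis by (simp add: l2_inner_powi_monomial)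
qed

lemma H2_iff: "f \<in> H2 \<longleftrightarrow> f \<in> L2 \<and> (\<forall>n<0. \<forall>y. l2_inner f (monomial n y) = 0)"
proof -
  have "fourier_coeff f n = 0 \<longleftrightarrow> (\<forall>y. l2_inner f (monomial n y) = 0)" if "f \<in> L2" for n
    using cinner_ext[of "fourier_coeff f n" 0] by (auto simp flip: cinner_fourier_coeff[OF that])
  then show ?thesis by (auto simp: H2_def)
qed

lemma H2_L2: "f \<in> H2 \<Longrightarrow> f \<in> L2"
  by (simp add: H2_def)

lemma H2_monomial: "n \<ge> 0 \<Longrightarrow> monomial n y \<in> H2"
  by (simp add: H2_iff l2_inner_monomials)

section \<open>Density of trigonometric polynomials\<close>

text \<open>Only the values on the circle matter, so trigonometric polynomials are determined up to their
  values elsewhere; this keeps them closed under products despite \<open>0 powi n\<close>.\<close>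

inductive trig_poly :: "(complex \<Rightarrow> 'h::fd_complex_hilbert) \<Rightarrow> bool" where
  monomial: "(\<And>z. norm z = 1 \<Longrightarrow> p z = monomial n y z) \<Longrightarrow> trig_poly p"
| add: "trig_poly p \<Longrightarrow> trig_poly q \<Longrightarrow> (\<And>z. norm z = 1 \<Longrightarrow> r z = p z + q z) \<Longrightarrow> trig_poly r"

lemma L2_cong:
  assumes "f \<in> L2" "\<And>z. norm z = 1 \<Longrightarrow> g z = f z"
  shows "g \<in> L2"
proof (rule L2_dominated[OF _ assms(1), where K = 1])
  have "g \<in> borel_measurable circle \<longleftrightarrow> f \<in> borel_measurable circle"
    by (rule measurable_cong) (simp add: assms(2))
  then show "g \<in> borel_measurable circle" using L2_measurable[OF assms(1)] by simp
  show "AE z in circle. norm (g z) \<le> 1 * norm (f z)" by (rule AE_I2) (simp add: assms(2))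
qed

lemma L2_trig_poly: "trig_poly p \<Longrightarrow> p \<in> L2"
proof (induction rule: trig_poly.induct)
  case (monomial p n y)
  then show ?case using L2_cong[OF L2_monomial] by blast
next
  case (add p q r)
  then show ?case using L2_cong[OF L2_add] by blast
qed

lemma trig_poly_scaleC:
  fixes p :: "complex \<Rightarrow> complex" and q :: "complex \<Rightarrow> 'h::fd_complex_hilbert"
  assumes "trig_poly p" "trig_poly q"
  shows "trig_poly (\<lambda>z. p z *\<^sub>C q z)"
  using assms(1)
proof (induction rule: trig_poly.induct)
  case (monomial p n c)
  note p = monomial.hyps
  show ?case using assms(2)
  proof (induction rule: trig_poly.induct)
    case (monomial q m y)
    show ?case
    proof (rule trig_poly.monomial)
      fix z :: complex assume z: "norm z = 1"
      show "p z *\<^sub>C q z = monomial (n + m) (c *\<^sub>C y) z"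
        unfolding monomial.hyps[OF z] p[OF z]
        by (simp only: monomial_def scaleC_scaleC scaleC_complex_def powi_add_unit[OF z] mult_ac)
    qed
  next
    case (add q1 q2 q)
    then show ?case by (intro trig_poly.add[OF add.IH]) (simp add: scaleC_add_right)
  qed
next
  case (add p1 p2 p)
  then show ?case by (intro trig_poly.add[OF add.IH]) (simp add: scaleC_add_left)
qed

text \<open>On the circle \<open>cnj z = 1 / z\<close>, so \<open>Re z\<close> and \<open>Im z\<close> are combinations of \<open>z\<close> and its inverse.\<close>

lemma trig_poly_real_polynomial:
  assumes "real_polynomial_function (g :: complex \<Rightarrow> real)"
  shows "trig_poly (\<lambda>z. complex_of_real (g z))"
  using assms
proof (induction rule: real_polynomial_function.induct)
  case (linear f)
  have f: "f z = Re z * f 1 + Im z * f \<i>" for z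
  proof -
    have "z = Re z *\<^sub>R 1 + Im z *\<^sub>R \<i>" by (simp add: complex_eq_iff)
    then have "f z = f (Re z *\<^sub>R 1 + Im z *\<^sub>R \<i>)" by (rule arg_cong)
    then show ?thesis 
      by (simp add: linear_add[OF bounded_linear.linear[OF linear]]
          linear_scale[OF bounded_linear.linear[OF linear]])
  qed
  have inv: "cnj z = z powi (- 1)" if "norm z = 1" for z :: complex
    using cnj_powi_unit[OF that, of 1] by simp
  have "complex_of_real (f z) = monomial 1 ((f 1 - \<i> * f \<i>) / 2) z + monomial (- 1) ((f 1 + \<i> * f \<i>) / 2) z"
    if "norm z = 1" for z
    unfolding monomial_def inv[OF that, symmetric] scaleC_complex_def
    by (subst f) (simp add: complex_eq_iff field_simps)
  then show ?case by (rule trig_poly.add[OF trig_poly.monomial trig_poly.monomial, OF refl refl])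
next
  case (const c)
  show ?case by (rule trig_poly.monomial[where n = 0 and y = "of_real c"]) (simp add: monomial_0)
next
  case (add f g)
  then show ?case by (intro trig_poly.add[OF add.IH]) simp
next
  case (mult f g)
  then show ?case using trig_poly_scaleC[OF mult.IH] by (simp add: scaleC_complex_def)
qed

definition trig_approximable :: "(complex \<Rightarrow> 'h::fd_complex_hilbert) \<Rightarrow> bool"
  where "trig_approximable f \<longleftrightarrow> f \<in> L2 \<and>
    (\<forall>e>0. \<exists>p. trig_poly p \<and> (LINT z|circle. (norm (f z - p z))\<^sup>2) < e)"

lemma L2_square_triangle:
  assumes "f \<in> L2" "g \<in> L2" "h \<in> L2"
    and "\<And>z. norm z = 1 \<Longrightarrow> h z = f z + g z"
  shows "(LINT z|circle. (norm (h z))\<^sup>2)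
    \<le> 2 * (LINT z|circle. (norm (f z))\<^sup>2) + 2 * (LINT z|circle. (norm (g z))\<^sup>2)"
proof -
  have "(LINT z|circle. (norm (h z))\<^sup>2) \<le> (LINT z|circle. 2 * (norm (f z))\<^sup>2 + 2 * (norm (g z))\<^sup>2)"
    by (intro integral_mono Bochner_Integration.integrable_add integrable_mult_right L2_integrable assms(1-3))
      (simp add: assms(4) norm_add_square_le)
  then show ?thesis using assms by (simp add: L2_integrable)
qed

lemma trig_approximable_trig_poly: "trig_poly p \<Longrightarrow> trig_approximable p"
  unfolding trig_approximable_def by (auto intro!: L2_trig_poly exI[of _ p])

lemma trig_approximable_add:
  assumes "trig_approximable f" "trig_approximable g"
  shows "trig_approximable (\<lambda>z. f z + g z)"
  unfolding trig_approximable_def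
proof (intro conjI allI impI)
  show "(\<lambda>z. f z + g z) \<in> L2" using assms by (auto simp: trig_approximable_def intro: L2_add)
  fix e :: real assume "e > 0"
  then have "e / 4 > 0" by simp
  then obtain p q where
    p: "trig_poly p" "(LINT z|circle. (norm (f z - p z))\<^sup>2) < e / 4" and
    q: "trig_poly q" "(LINT z|circle. (norm (g z - q z))\<^sup>2) < e / 4"
    using assms unfolding trig_approximable_def by meson
  note L2 = assms[unfolded trig_approximable_def] p(1)[THEN L2_trig_poly] q(1)[THEN L2_trig_poly]
  have "(LINT z|circle. (norm (f z + g z - (p z + q z)))\<^sup>2)
      \<le> 2 * (LINT z|circle. (norm (f z - p z))\<^sup>2) + 2 * (LINT z|circle. (norm (g z - q z))\<^sup>2)"
    using L2 by (intro L2_square_triangle L2_diff L2_add) auto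
  also have "\<dots> < e" using p(2) q(2) by simp
  finally show "\<exists>r. trig_poly r \<and> (LINT z|circle. (norm (f z + g z - r z))\<^sup>2) < e"
    using trig_poly.add[OF p(1) q(1) refl] by blast
qed

lemma trig_approximable_sum:
  assumes "finite I" "\<And>i. i \<in> I \<Longrightarrow> trig_approximable (F i)"
  shows "trig_approximable (\<lambda>z. \<Sum>i\<in>I. F i z)"
  using assms
proof (induction I rule: finite_induct)
  case empty
  show ?case
    by (rule trig_approximable_trig_poly, rule trig_poly.monomial[where n = 0 and y = 0]) (simp add: monomial_0)
next
  case (insert i I)
  then show ?case using trig_approximable_add[of "F i" "\<lambda>z. \<Sum>i\<in>I. F i z"] by simp
qed

text \<open>By dominated convergence, pointwise convergence under an \<open>L\<^sup>2\<close> bound is convergence in \<open>L\<^sup>2\<close>. All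
  further approximations reduce to this one.\<close>

lemma trig_approximable_limit:
  assumes approx: "\<And>n. trig_approximable (F n)" and f[measurable]: "f \<in> borel_measurable circle"
    and lim: "\<And>z. norm z = 1 \<Longrightarrow> (\<lambda>n. F n z) \<longlonglongrightarrow> f z"
    and w: "w \<in> L2" and dom: "\<And>n z. norm z = 1 \<Longrightarrow> norm (F n z) \<le> norm (w z)"
  shows "trig_approximable f"
  unfolding trig_approximable_def
proof (intro conjI allI impI)
  have F: "F n \<in> L2" for n using approx by (simp add: trig_approximable_def)
  note [measurable] = L2_measurable[OF F] L2_measurable[OF w]
  have bound: "norm (f z) \<le> norm (w z)" if "norm z = 1" for z
    by (rule LIMSEQ_le_const2[OF tendsto_norm[OF lim[OF that]]]) (use dom[OF that] in blast)
  show L2f: "f \<in> L2"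
    by (rule L2_dominated[OF f w, where K = 1]) (auto intro!: AE_I2 bound)
  have "(\<lambda>n. LINT z|circle. (norm (f z - F n z))\<^sup>2) \<longlonglongrightarrow> (LINT z|circle. 0)"
  proof (rule integral_dominated_convergence)
    show "integrable circle (\<lambda>z. 4 * (norm (w z))\<^sup>2)" using L2_integrable[OF w] by simp
    show "AE z in circle. (\<lambda>n. (norm (f z - F n z))\<^sup>2) \<longlonglongrightarrow> 0"
    proof (rule AE_I2)
      fix z :: complex assume "z \<in> space circle"
      then have "(\<lambda>n. (norm (f z - F n z))\<^sup>2) \<longlonglongrightarrow> (norm (f z - f z))\<^sup>2"
        by (intro tendsto_intros lim) simp
      then show "(\<lambda>n. (norm (f z - F n z))\<^sup>2) \<longlonglongrightarrow> 0" by simp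
    qed
    show "AE z in circle. norm ((norm (f z - F n z))\<^sup>2) \<le> 4 * (norm (w z))\<^sup>2" for n
    proof (rule AE_I2)
      fix z :: complex assume "z \<in> space circle"
      then have z: "norm z = 1" by simp
      have "norm (f z - F n z) \<le> 2 * norm (w z)"
        using norm_triangle_ineq4[of "f z" "F n z"] bound[OF z] dom[OF z, of n] by linarith
      then have "(norm (f z - F n z))\<^sup>2 \<le> (2 * norm (w z))\<^sup>2" by (intro power_mono) auto
      then show "norm ((norm (f z - F n z))\<^sup>2) \<le> 4 * (norm (w z))\<^sup>2"
        by (simp add: power_mult_distrib)
    qed
  qed (measurable, measurable)
  then have lim0: "(\<lambda>n. LINT z|circle. (norm (f z - F n z))\<^sup>2) \<longlonglongrightarrow> 0" by simp
  fix e :: real assume "e > 0"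
  then have "e / 4 > 0" by simp
  from order_tendstoD(2)[OF lim0 this]
  obtain n where n: "(LINT z|circle. (norm (f z - F n z))\<^sup>2) < e / 4"
    by (auto simp: eventually_sequentially)
  obtain p where p: "trig_poly p" "(LINT z|circle. (norm (F n z - p z))\<^sup>2) < e / 4"
    using approx \<open>e / 4 > 0\<close> unfolding trig_approximable_def by meson
  have "(LINT z|circle. (norm (f z - p z))\<^sup>2)
      \<le> 2 * (LINT z|circle. (norm (f z - F n z))\<^sup>2) + 2 * (LINT z|circle. (norm (F n z - p z))\<^sup>2)"
    using L2f F L2_trig_poly[OF p(1)] by (intro L2_square_triangle L2_diff) auto
  also have "\<dots> < e" using n p(2) by simp
  finally show "\<exists>p. trig_poly p \<and> (LINT z|circle. (norm (f z - p z))\<^sup>2) < e" using p(1) by blast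
qed

text \<open>Stone--Weierstrass gives uniform approximation by real polynomials in \<open>Re z\<close> and \<open>Im z\<close>.\<close>

lemma trig_approximable_continuous:
  fixes \<phi> :: "complex \<Rightarrow> real" and y :: "'h::fd_complex_hilbert"
  assumes cont: "continuous_on (sphere 0 1) \<phi>"
  shows "trig_approximable (\<lambda>z. \<phi> z *\<^sub>R y)"
proof -
  have "\<forall>n. \<exists>g. real_polynomial_function g \<and> (\<forall>z\<in>sphere 0 1. \<bar>\<phi> z - g z\<bar> < 1 / real (Suc n))"
  proof
    fix n
    have "0 < 1 / real (Suc n)" by simp
    then obtain g where "real_polynomial_function g"
        "\<And>z. z \<in> sphere 0 1 \<Longrightarrow> \<bar>\<phi> z - g z\<bar> < 1 / real (Suc n)"
      by (rule Stone_Weierstrass_real_polynomial_function[OF compact_sphere cont]) rule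
    then show "\<exists>g. real_polynomial_function g \<and> (\<forall>z\<in>sphere 0 1. \<bar>\<phi> z - g z\<bar> < 1 / real (Suc n))"
      by (intro exI[of _ g]) simp
  qed
  from choice[OF this] obtain g where
    *: "\<forall>n. real_polynomial_function (g n) \<and> (\<forall>z\<in>sphere 0 1. \<bar>\<phi> z - g n z\<bar> < 1 / real (Suc n))" ..
  have g: "real_polynomial_function (g n)" for n using * by blast
  have close: "\<bar>\<phi> z - g n z\<bar> < 1 / real (Suc n)" if "norm z = 1" for n z using * that by simp
  have "bounded (\<phi> ` sphere 0 1)"
    by (intro compact_imp_bounded compact_continuous_image cont compact_sphere)
  then obtain K where "\<forall>x\<in>\<phi> ` sphere 0 1. norm x \<le> K" unfolding bounded_iff ..
  then have K: "\<bar>\<phi> z\<bar> \<le> K" if "norm z = 1" for z using that by simp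
  show ?thesis
  proof (rule trig_approximable_limit)
    show "trig_approximable (\<lambda>z. g n z *\<^sub>R y)" for n
      using trig_poly_scaleC[OF trig_poly_real_polynomial[OF g] trig_poly.monomial, OF refl, of n 0 y]
      by (intro trig_approximable_trig_poly) (simp add: monomial_0 scaleC_of_real)
    show "(\<lambda>z. \<phi> z *\<^sub>R y) \<in> borel_measurable circle"
      by (intro borel_measurable_circle_continuous continuous_intros cont)
    show "(\<lambda>n. g n z *\<^sub>R y) \<longlonglongrightarrow> \<phi> z *\<^sub>R y" if "norm z = 1" for z
    proof (intro tendsto_intros)
      have "(\<lambda>n. g n z - \<phi> z) \<longlonglongrightarrow> 0"
      proof (rule Lim_null_comparison[OF _ LIMSEQ_inverse_real_of_nat], rule always_eventually, rule allI)
        show "norm (g n z - \<phi> z) \<le> inverse (real (Suc n))" for n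
          using close[OF that, of n] by (simp add: inverse_eq_divide abs_minus_commute)
      qed
      then show "(\<lambda>n. g n z) \<longlonglongrightarrow> \<phi> z" by (simp add: LIM_zero_iff)
    qed
    show "(\<lambda>z. (K + 1) *\<^sub>R y) \<in> L2" by (rule L2_const)
    show "norm (g n z *\<^sub>R y) \<le> norm ((K + 1) *\<^sub>R y)" if "norm z = 1" for n z
    proof -
      have "1 / real (Suc n) \<le> 1" by simp
      then have "\<bar>g n z\<bar> \<le> \<bar>K + 1\<bar>" using close[OF that, of n] K[OF that] by linarith
      then show ?thesis by (simp add: mult_right_mono)
    qed
  qed
qed

lemma borel_measurable_indicator_circle:
  "A \<in> sets borel \<Longrightarrow> (\<lambda>z. indicator A z *\<^sub>R y) \<in> borel_measurable circle"
  for y :: "'h::fd_complex_hilbert"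
  using measurable_restrict_space1[of "indicator A" borel borel "sphere 0 1"]
  by (intro borel_measurable_scaleR) (simp_all add: sets_circle cong: measurable_cong_sets)

text \<open>Closed sets generate the Borel sets and are stable under intersection. Their indicators are limits of
  continuous functions, and the class of sets with approximable indicators is closed under complements
  and countable disjoint unions. The vector \<open>y\<close> varies because complements need \<open>- y\<close>.\<close>

lemma trig_approximable_indicator:
  fixes y :: "'h::fd_complex_hilbert"
  assumes "A \<in> sets (borel :: complex measure)"
  shows "trig_approximable (\<lambda>z. indicator A z *\<^sub>R y)"
proof -
  have bounded: "norm (indicator B z *\<^sub>R y) \<le> norm y" for B :: "complex set" and z and y :: 'h
    by (simp add: indicator_def)
  have "Int_stable (Collect closed :: complex set set)" by (auto intro!: Int_stableI)
  moreover have "Collect closed \<subseteq> Pow (UNIV :: complex set)" by simp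
  moreover have borel: "sigma_sets UNIV (Collect closed :: complex set set) = sets borel"
    by (simp add: borel_eq_closed)
  then have "A \<in> sigma_sets UNIV (Collect closed)" using assms by simp
  ultimately have "\<forall>y :: 'h. trig_approximable (\<lambda>z. indicator A z *\<^sub>R y)"
  proof (induction rule: sigma_sets_induct_disjoint)
    case (basic A)
    then have A: "closed A" by simp
    show ?case
    proof (cases "A = {}")
      case False
      \<comment> \<open>The powers of \<open>1 / (1 + dist z A)\<close> decrease to the indicator of \<open>A\<close>.\<close>
      define q where "q z = 1 / (1 + infdist z A)" for z
      have ne: "1 + infdist z A \<noteq> 0" for z using infdist_nonneg[of z A] by linarith
      have q: "0 \<le> q z" "q z \<le> 1" for z
        using infdist_nonneg[of z A] by (simp_all add: q_def divide_le_eq_1)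
      show ?thesis
      proof (intro allI, rule trig_approximable_limit)
        fix y :: 'h
        show "trig_approximable (\<lambda>z. (q z ^ n) *\<^sub>R y)" for n
          unfolding q_def
          by (intro trig_approximable_continuous continuous_intros) (simp add: ne)
        show "(\<lambda>z. indicator A z *\<^sub>R y) \<in> borel_measurable circle"
          using A by (intro borel_measurable_indicator_circle) auto
        show "(\<lambda>n. (q z ^ n) *\<^sub>R y) \<longlonglongrightarrow> indicator A z *\<^sub>R y" for z
        proof (intro tendsto_intros)
          show "(\<lambda>n. q z ^ n) \<longlonglongrightarrow> indicator A z"
          proof (cases "z \<in> A")
            case True
            then show ?thesis by (simp add: q_def)
          next
            case False
            then have "infdist z A > 0"
              using in_closed_iff_infdist_zero[OF A \<open>A \<noteq> {}\<close>, of z] infdist_nonneg[of z A] by simp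
            then have "\<bar>q z\<bar> < 1" by (simp add: q_def)
            then show ?thesis using False by (simp add: LIMSEQ_power_zero)
          qed
        qed
        show "(\<lambda>z. y) \<in> L2" by (rule L2_const)
        show "norm ((q z ^ n) *\<^sub>R y) \<le> norm y" for n z
          using power_le_one[OF q, of z n] q[of z] by (simp add: mult_left_le_one_le)
      qed
    qed (simp add: trig_approximable_sum[of "{}", simplified])
  next
    case empty
    show ?case by (simp add: trig_approximable_sum[of "{}", simplified])
  next
    case (compl A)
    show ?case
    proof
      fix y :: 'h
      have "trig_approximable (\<lambda>z. y + indicator A z *\<^sub>R (- y))"
      proof (rule trig_approximable_add)
        show "trig_approximable (\<lambda>z. y)"
          by (rule trig_approximable_trig_poly, rule trig_poly.monomial[where n = 0 and y = y])
            (simp add: monomial_0)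
        show "trig_approximable (\<lambda>z. indicator A z *\<^sub>R (- y))" using compl(2) by blast
      qed
      moreover have "(\<lambda>z. y + indicator A z *\<^sub>R (- y)) = (\<lambda>z. indicator (UNIV - A) z *\<^sub>R y)"
        by (auto simp: indicator_def)
      ultimately show "trig_approximable (\<lambda>z. indicator (UNIV - A) z *\<^sub>R y)" by simp
    qed
  next
    case (union A)
    then have A: "A i \<in> sets borel" for i unfolding borel by auto
    show ?case
    proof (intro allI, rule trig_approximable_limit)
      fix y :: 'h
      show "trig_approximable (\<lambda>z. indicator (\<Union>i<n. A i) z *\<^sub>R y)" for n
      proof -
        have "indicator (\<Union>i<n. A i) z *\<^sub>R y = (\<Sum>i<n. indicator (A i) z *\<^sub>R y)" for z
          using union(1)
          by (subst indicator_UN_disjoint)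
            (auto simp: scaleR_sum_left disjoint_family_on_def)
        moreover have "trig_approximable (\<lambda>z. \<Sum>i<n. indicator (A i) z *\<^sub>R y)"
          using union(3) by (intro trig_approximable_sum) simp_all
        ultimately show ?thesis by presburger
      qed
      show "(\<lambda>z. indicator (\<Union>i. A i) z *\<^sub>R y) \<in> borel_measurable circle"
        using A by (intro borel_measurable_indicator_circle) auto
      show "(\<lambda>n. indicator (\<Union>i<n. A i) z *\<^sub>R y) \<longlonglongrightarrow> indicator (\<Union>i. A i) z *\<^sub>R y" for z
        by (intro tendsto_intros LIMSEQ_indicator_UN)
    qed (rule L2_const, rule bounded)
  qed
  then show ?thesis ..
qed

text \<open>Every \<open>L\<^sup>2\<close> function is a dominated pointwise limit of simple functions, which are sums of indicators.\<close>

lemma trig_approximable_L2: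
  assumes "f \<in> L2"
  shows "trig_approximable f"
proof -
  note f = L2_measurable[OF assms]
  from borel_measurable_implies_sequence_metric[OF f, of 0] obtain F where
    *: "(\<forall>n. simple_function circle (F n)) \<and> (\<forall>z\<in>space circle. (\<lambda>n. F n z) \<longlonglongrightarrow> f z) \<and>
      (\<forall>n. \<forall>z\<in>space circle. dist (F n z) 0 \<le> 2 * dist (f z) 0)" ..
  have F: "simple_function circle (F n)"
    "norm z = 1 \<Longrightarrow> (\<lambda>n. F n z) \<longlonglongrightarrow> f z"
    "norm z = 1 \<Longrightarrow> norm (F n z) \<le> 2 * norm (f z)" for n z
    using * by simp_all
  show ?thesis
  proof (rule trig_approximable_limit[OF _ f F(2)])
    show "(\<lambda>z. 2 *\<^sub>R f z) \<in> L2"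
      using assms by (rule L2_linear[OF bounded_linear_scaleR_right])
    show "norm (F n z) \<le> norm (2 *\<^sub>R f z)" if "norm z = 1" for n z using F(3)[OF that] by simp
    fix n
    define A where "A v = F n -` {v} \<inter> sphere 0 1" for v
    have "A v \<in> sets borel" for v
    proof -
      have "A v \<in> sets (restrict_space borel (sphere 0 1))"
        using simple_functionD(2)[OF F(1), of n "{v}"] by (simp add: A_def sets_circle)
      then show ?thesis by (auto simp: sets_restrict_space)
    qed
    then have approx: "trig_approximable (\<lambda>z. \<Sum>v\<in>F n ` sphere 0 1. indicator (A v) z *\<^sub>R v)"
      using simple_functionD(1)[OF F(1), of n]
      by (intro trig_approximable_sum trig_approximable_indicator) simp_all
    have eq: "F n z = (\<Sum>v\<in>F n ` sphere 0 1. indicator (A v) z *\<^sub>R v)" if "norm z = 1" for z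
    proof -
      have "z \<in> space circle" using that by simp
      from simple_function_indicator_representation_banach[OF F(1) this]
      show ?thesis unfolding A_def space_circle .
    qed
    \<comment> \<open>The sum equals \<open>F n\<close> only on the circle; a constant sequence transfers approximability across that.\<close>
    show "trig_approximable (F n)"
    proof (rule trig_approximable_limit[OF approx])
      show "F n \<in> borel_measurable circle" using F(1) by (rule borel_measurable_simple_function)
      show "(\<lambda>_. \<Sum>v\<in>F n ` sphere 0 1. indicator (A v) z *\<^sub>R v) \<longlonglongrightarrow> F n z" if "norm z = 1" for z
        by (simp add: eq[OF that])
      show "(\<lambda>z. \<Sum>v\<in>F n ` sphere 0 1. indicator (A v) z *\<^sub>R v) \<in> L2"
        using approx by (simp add: trig_approximable_def)
    qed simp
  qed
qed

lemma trig_poly_dense: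
  assumes "f \<in> L2" "e > 0"
  obtains p where "trig_poly p" "(LINT z|circle. (norm (f z - p z))\<^sup>2) < e"
proof -
  have "\<exists>p. trig_poly p \<and> (LINT z|circle. (norm (f z - p z))\<^sup>2) < e"
    using trig_approximable_L2[OF assms(1)] assms(2) by (simp add: trig_approximable_def)
  then show thesis using that by (elim exE conjE)
qed

lemma l2_diff_square:
  assumes "f \<in> L2" "g \<in> L2"
  shows "(LINT z|circle. (norm (f z - g z))\<^sup>2) =
    (LINT z|circle. (norm (f z))\<^sup>2) + (LINT z|circle. (norm (g z))\<^sup>2) - 2 * Re (l2_inner f g)"
  using assms L2_integrable[OF assms(1)] L2_integrable[OF assms(2)] L2_integrable_cinner[OF assms]
  by (simp add: norm_diff_square l2_inner_def)

text \<open>Such an \<open>f\<close> is orthogonal to every trigonometric polynomial \<open>p\<close>, so \<open>\<parallel>f - p\<parallel>\<^sup>2 = \<parallel>f\<parallel>\<^sup>2 + \<parallel>p\<parallel>\<^sup>2\<close> cannot be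
  smaller than \<open>\<parallel>f\<parallel>\<^sup>2\<close>.\<close>

lemma L2_eq_0_if_fourier_0:
  assumes f: "f \<in> L2" and 0: "\<And>n y. l2_inner f (monomial n y) = 0"
  shows "AE z in circle. f z = 0"
proof -
  have orth: "l2_inner f p = 0" if "trig_poly p" for p
    using that
  proof (induction rule: trig_poly.induct)
    case (monomial p n y)
    then have "l2_inner f p = l2_inner f (monomial n y)"
      by (auto simp: l2_inner_def intro!: Bochner_Integration.integral_cong)
    then show ?case using 0 by simp
  next
    case (add p q r)
    have "l2_inner f r = l2_inner f (\<lambda>z. p z + q z)"
      by (auto simp: l2_inner_def add.hyps intro!: Bochner_Integration.integral_cong)
    then show ?case using f add by (simp add: l2_inner_add_right L2_trig_poly)
  qed
  have "(LINT z|circle. (norm (f z))\<^sup>2) \<le> 0 + e" if e: "e > 0" for e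
  proof -
    obtain p where p: "trig_poly p" "(LINT z|circle. (norm (f z - p z))\<^sup>2) < e"
      using e by (rule trig_poly_dense[OF f])
    have "(LINT z|circle. (norm (p z))\<^sup>2) \<ge> 0" by simp
    moreover have "(LINT z|circle. (norm (f z - p z))\<^sup>2)
        = (LINT z|circle. (norm (f z))\<^sup>2) + (LINT z|circle. (norm (p z))\<^sup>2)"
      using l2_diff_square[OF f L2_trig_poly[OF p(1)]] orth[OF p(1)] by simp
    ultimately show ?thesis using p(2) by linarith
  qed
  then have "(LINT z|circle. (norm (f z))\<^sup>2) \<le> 0" by (rule field_le_epsilon)
  then have "(LINT z|circle. (norm (f z))\<^sup>2) = 0" by (simp add: antisym)
  then show ?thesis using integral_nonneg_eq_0_iff_AE[OF L2_integrable[OF f]] by simp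
qed

lemma L2_eq_if_inner_eq:
  assumes "f \<in> L2" "g \<in> L2" "\<And>n y. l2_inner f (monomial n y) = l2_inner g (monomial n y)"
  shows "l2_eq f g"
  using L2_eq_0_if_fourier_0[OF L2_diff[OF assms(1,2)]] assms by (simp add: l2_inner_diff_left l2_eq_def)

text \<open>A trigonometric polynomial \<open>p\<close> close to \<open>g\<close> splits into an analytic part \<open>a\<close>, which is orthogonal to
  \<open>q\<close>, and a part \<open>b\<close> with only negative powers, which is orthogonal to \<open>H\<^sup>2\<close>. By Pythagoras, dropping
  \<open>b\<close> does not increase the distance to \<open>g\<close>, so \<open>\<langle>g, q\<rangle> = \<langle>g - a, q\<rangle>\<close> is arbitrarily small.\<close>

lemma H2_orthogonal:
  assumes g: "g \<in> H2" and q: "q \<in> L2" and orth: "\<And>n y. n \<ge> 0 \<Longrightarrow> l2_inner (monomial n y) q = 0"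
  shows "l2_inner g q = 0"
proof -
  define splits where "splits p a b \<longleftrightarrow> a \<in> H2 \<and> b \<in> L2 \<and> (\<forall>z. norm z = 1 \<longrightarrow> p z = a z + b z) \<and>
      l2_inner a q = 0 \<and> (\<forall>h\<in>H2. l2_inner h b = 0)" for p a b
  have split: "\<exists>a b. splits p a b" if "trig_poly p" for p
    using that
  proof (induction rule: trig_poly.induct)
    case (monomial p n y)
    have zero: "l2_inner h (\<lambda>z. 0) = 0" "l2_inner (\<lambda>z. 0) h = 0" for h :: "complex \<Rightarrow> 'a"
      by (simp_all add: l2_inner_def)
    show ?case
    proof (cases "n \<ge> 0")
      case True
      then have "splits p (monomial n y) (\<lambda>z. 0)"
        using monomial orth[of n y] by (auto simp: splits_def H2_monomial L2_const zero)
      then show ?thesis by blast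
    next
      case False
      then have "splits p (\<lambda>z. 0) (monomial n y)"
        using monomial by (auto simp: splits_def H2_iff L2_const zero)
      then show ?thesis by blast
    qed
  next
    case (add p1 p2 p)
    from add.IH obtain a1 b1 a2 b2 where 1: "splits p1 a1 b1" and 2: "splits p2 a2 b2" by blast
    have L2: "a1 \<in> L2" "a2 \<in> L2" "b1 \<in> L2" "b2 \<in> L2" using 1 2 by (auto simp: splits_def H2_L2)
    have "splits p (\<lambda>z. a1 z + a2 z) (\<lambda>z. b1 z + b2 z)"
      unfolding splits_def
    proof (intro conjI allI impI ballI)
      show "(\<lambda>z. a1 z + a2 z) \<in> H2" using 1 2 by (simp add: splits_def H2_iff L2_add l2_inner_add_left)
      show "p z = a1 z + a2 z + (b1 z + b2 z)" if "norm z = 1" for z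
        using 1 2 that add.hyps(3)[OF that] by (simp add: splits_def)
      show "l2_inner (\<lambda>z. a1 z + a2 z) q = 0" using 1 2 L2 q by (simp add: splits_def l2_inner_add_left)
      show "l2_inner h (\<lambda>z. b1 z + b2 z) = 0" if "h \<in> H2" for h
        using 1 2 L2 that H2_L2[OF that] by (simp add: splits_def l2_inner_add_right)
    qed (rule L2_add[OF L2(3,4)])
    then show ?case by blast
  qed
  have gL: "g \<in> L2" using g by (rule H2_L2)
  define Q where "Q = (LINT z|circle. (norm (q z))\<^sup>2)"
  have bound: "cmod (l2_inner g q) \<le> (1 + Q) * e" if "e > 0" for e
  proof -
    have "e\<^sup>2 > 0" using that by simp
    then obtain p where p: "trig_poly p" "(LINT z|circle. (norm (g z - p z))\<^sup>2) < e\<^sup>2"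
      by (rule trig_poly_dense[OF gL])
    obtain a b where "splits p a b" using split[OF p(1)] by blast
    then have ab: "a \<in> L2" "b \<in> L2" "\<And>z. norm z = 1 \<Longrightarrow> p z = a z + b z" "l2_inner a q = 0"
        "a \<in> H2" "\<And>h. h \<in> H2 \<Longrightarrow> l2_inner h b = 0" by (auto simp: splits_def H2_L2)
    define r where "r = (\<lambda>z. g z - a z)"
    have r: "r \<in> L2" unfolding r_def by (rule L2_diff[OF gL ab(1)])
    have "l2_inner r b = 0"
      unfolding r_def using gL ab g by (simp add: l2_inner_diff_left)
    then have "(LINT z|circle. (norm (r z - b z))\<^sup>2) \<ge> (LINT z|circle. (norm (r z))\<^sup>2)"
      using l2_diff_square[OF r ab(2)] by simp
    moreover have "(LINT z|circle. (norm (r z - b z))\<^sup>2) = (LINT z|circle. (norm (g z - p z))\<^sup>2)"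
      by (intro Bochner_Integration.integral_cong) (auto simp: r_def ab(3) algebra_simps)
    ultimately have rsmall: "(LINT z|circle. (norm (r z))\<^sup>2) \<le> e\<^sup>2" using p(2) by simp
    have "l2_inner g q = l2_inner r q"
      unfolding r_def using gL ab q by (simp add: l2_inner_diff_left)
    then have "cmod (l2_inner g q) \<le> (LINT z|circle. cmod (cinner (r z) (q z)))"
      by (simp add: l2_inner_def integral_norm_bound)
    \<comment> \<open>The weights \<open>1 / e\<close> and \<open>e\<close> balance \<open>\<parallel>r\<parallel>\<^sup>2 \<le> e\<^sup>2\<close> against the fixed norm of \<open>q\<close>.\<close>
    also have "\<dots> \<le> (LINT z|circle. (norm (r z))\<^sup>2 / e + e * (norm (q z))\<^sup>2)"
    proof (rule integral_mono)
      show "integrable circle (\<lambda>z. cmod (cinner (r z) (q z)))"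
        by (rule integrable_norm[OF L2_integrable_cinner[OF r q]])
      show "integrable circle (\<lambda>z. (norm (r z))\<^sup>2 / e + e * (norm (q z))\<^sup>2)"
        using L2_integrable[OF r] L2_integrable[OF q] by simp
      fix z
      have "2 * (norm (r z) * (e * norm (q z))) \<le> (norm (r z))\<^sup>2 + (e * norm (q z))\<^sup>2"
        using sum_squares_bound[of "norm (r z)" "e * norm (q z)"] by (simp add: mult.assoc)
      moreover have "0 \<le> norm (r z) * (e * norm (q z))" using that by simp
      ultimately have "norm (r z) * (e * norm (q z)) \<le> (norm (r z))\<^sup>2 + (e * norm (q z))\<^sup>2" by linarith
      then have "norm (r z) * norm (q z) \<le> (norm (r z))\<^sup>2 / e + e * (norm (q z))\<^sup>2"
        using that by (simp add: field_simps power2_eq_square)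
      then show "cmod (cinner (r z) (q z)) \<le> (norm (r z))\<^sup>2 / e + e * (norm (q z))\<^sup>2"
        using norm_cinner_le[of "r z" "q z"] by linarith
    qed
    also have "\<dots> = (LINT z|circle. (norm (r z))\<^sup>2) / e + e * Q"
      using L2_integrable[OF r] L2_integrable[OF q] by (simp add: Q_def)
    also have "\<dots> \<le> e\<^sup>2 / e + e * Q"
      using rsmall that by (intro add_right_mono divide_right_mono) auto
    also have "\<dots> = (1 + Q) * e" using that by (simp add: power2_eq_square algebra_simps)
    finally show ?thesis .
  qed
  have Q: "1 + Q > 0" unfolding Q_def by (intro add_pos_nonneg) auto
  have "cmod (l2_inner g q) \<le> 0 + e" if "e > 0" for e
    using bound[of "e / (1 + Q)"] that Q by simp
  then have "cmod (l2_inner g q) \<le> 0" by (rule field_le_epsilon)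
  then show ?thesis by simp
qed

lemma l2_inner_eq:
  assumes "l2_eq f f'" "l2_eq g g'" "f \<in> L2" "f' \<in> L2" "g \<in> L2" "g' \<in> L2"
  shows "l2_inner f g = l2_inner f' g'"
proof (rule l2_inner_cong)
  show "AE z in circle. cinner (f z) (g z) = cinner (f' z) (g' z)"
    using assms(1,2) unfolding l2_eq_def by eventually_elim simp
qed (use assms(3-) in \<open>auto simp: L2_measurable\<close>)

lemma l2_eq_refl [simp]: "l2_eq f f"
  by (simp add: l2_eq_def)

lemma l2_eq_sym: "l2_eq f g \<Longrightarrow> l2_eq g f"
  unfolding l2_eq_def by (auto elim: eventually_mono)

lemma l2_eq_trans [trans]: "l2_eq f g \<Longrightarrow> l2_eq g h \<Longrightarrow> l2_eq f h"
  unfolding l2_eq_def by (auto elim: eventually_elim2)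

lemma l2_eq_const:
  assumes "l2_eq (\<lambda>z. a) (\<lambda>z. b)"
  shows "a = b"
proof (rule cinner_ext)
  fix y
  have "l2_inner (monomial 0 a) (monomial 0 y) = l2_inner (monomial 0 b) (monomial 0 y)"
    by (rule l2_inner_eq) (use assms in \<open>simp_all add: monomial_0 L2_const\<close>)
  then show "cinner a y = cinner b y" by (simp add: l2_inner_monomials)
qed

lemma l2_eq_on_circle: "(\<And>z. norm z = 1 \<Longrightarrow> f z = g z) \<Longrightarrow> l2_eq f g"
  unfolding l2_eq_def by (rule AE_I2) simp

lemma l2_inner_zero_commute: "l2_inner f g = 0 \<longleftrightarrow> l2_inner g f = 0"
  using l2_inner_commute[of f g] by simp

lemma H2_powi: "f \<in> H2 \<Longrightarrow> n \<ge> 0 \<Longrightarrow> (\<lambda>z. z powi n *\<^sub>C f z) \<in> H2"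
  by (simp add: H2_iff L2_powi l2_inner_powi_monomial)

lemma H2_diff: "f \<in> H2 \<Longrightarrow> g \<in> H2 \<Longrightarrow> (\<lambda>z. f z - g z) \<in> H2"
  by (simp add: H2_iff L2_diff l2_inner_diff_left)

section \<open>Multiplication operators\<close>

lemma Linfty_bounded_clinear: "F \<in> Linfty \<Longrightarrow> norm z = 1 \<Longrightarrow> bounded_clinear (F z)"
  by (simp add: Linfty_def)

lemma Linfty_scaleC: "F \<in> Linfty \<Longrightarrow> norm z = 1 \<Longrightarrow> F z (a *\<^sub>C x) = a *\<^sub>C F z x"
  using Linfty_bounded_clinear unfolding bounded_clinear_def by blast

text \<open>Membership in \<open>Linfty\<close> only gives measurability of \<open>F z x\<close> for fixed \<open>x\<close>; a finite expansion of \<open>f z\<close>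
  reduces the general case to that.\<close>

lemma borel_measurable_mult:
  fixes F :: "complex \<Rightarrow> 'h::fd_complex_hilbert \<Rightarrow> 'h"
  assumes F: "F \<in> Linfty" and f: "f \<in> borel_measurable circle"
  shows "(\<lambda>z. F z (f z)) \<in> borel_measurable circle"
proof -
  obtain S :: "'h set" where S: "finite S" "\<And>x. x = (\<Sum>s\<in>S. (inner x s / inner s s) *\<^sub>R s)"
    using fd_orthogonal_expansion by blast
  have eq: "F z (f z) = (\<Sum>s\<in>S. (inner (f z) s / inner s s) *\<^sub>R F z s)" if "norm z = 1" for z
  proof -
    have lin: "linear (F z)"
      using Linfty_bounded_clinear[OF F that] by (simp add: bounded_clinear_def bounded_linear.linear)
    have "F z (f z) = F z (\<Sum>s\<in>S. (inner (f z) s / inner s s) *\<^sub>R s)"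
      using S(2)[of "f z"] by (rule arg_cong)
    then show ?thesis by (simp only: linear_sum[OF lin] linear_scale[OF lin])
  qed
  have "(\<lambda>z. F z s) \<in> borel_measurable circle" for s
    using F by (simp add: Linfty_def)
  then have "(\<lambda>z. \<Sum>s\<in>S. (inner (f z) s / inner s s) *\<^sub>R F z s) \<in> borel_measurable circle"
    using f by (intro borel_measurable_sum borel_measurable_scaleR borel_measurable_divide
        borel_measurable_inner) auto
  moreover have "(\<lambda>z. F z (f z)) \<in> borel_measurable circle \<longleftrightarrow>
      (\<lambda>z. \<Sum>s\<in>S. (inner (f z) s / inner s s) *\<^sub>R F z s) \<in> borel_measurable circle"
    by (rule measurable_cong) (simp add: eq)
  ultimately show ?thesis by simp
qed

lemma L2_mult:
  assumes F: "F \<in> Linfty" and f: "f \<in> L2"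
  shows "(\<lambda>z. F z (f z)) \<in> L2"
proof -
  obtain K where K: "AE z in circle. onorm (F z) \<le> K" using F by (auto simp: Linfty_def)
  show ?thesis
  proof (rule L2_dominated[OF borel_measurable_mult[OF F L2_measurable[OF f]] f])
    show "AE z in circle. norm (F z (f z)) \<le> K * norm (f z)"
      using K AE_circle_sphere
    proof eventually_elim
      fix z assume z: "onorm (F z) \<le> K" "norm z = 1"
      have "norm (F z (f z)) \<le> onorm (F z) * norm (f z)"
        using Linfty_bounded_clinear[OF F z(2)] by (intro onorm) (simp add: bounded_clinear_def)
      also have "\<dots> \<le> K * norm (f z)" using z(1) by (rule mult_right_mono) simp
      finally show "norm (F z (f z)) \<le> K * norm (f z)" .
    qed
  qed
qed

text \<open>Having an adjoint already forces linearity, by nondegeneracy of the inner product.\<close>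

lemma bounded_clinear_if_adjoint:
  fixes A :: "'h::fd_complex_hilbert \<Rightarrow> 'h"
  assumes "\<And>x y. cinner (A x) y = cinner x (B y)"
  shows "bounded_clinear A"
proof -
  have scale: "A (a *\<^sub>C x) = a *\<^sub>C A x" for a x
    by (rule cinner_ext) (simp add: assms cinner_scaleC_left)
  have "linear A"
  proof (rule linearI)
    show "A (x + y) = A x + A y" for x y by (rule cinner_ext) (simp add: assms cinner_add_left)
    show "A (r *\<^sub>R x) = r *\<^sub>R A x" for r x using scale[of "of_real r" x] by (simp add: scaleC_of_real)
  qed
  then show ?thesis using scale by (simp add: bounded_clinear_def bounded_linear_fd)
qed

section \<open>Symmetric inner functions\<close>

locale symmetric_inner =
  fixes \<Theta> :: "complex \<Rightarrow> 'h::fd_complex_hilbert \<Rightarrow> 'h" and J :: "'h \<Rightarrow> 'h"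
  assumes inner: "inner_function \<Theta>"
    and J: "conjugation J"
    and sym: "AE z in circle. symmetric_op J (\<Theta> z)"
begin

lemma Linfty: "\<Theta> \<in> Linfty"
  using inner by (simp add: inner_function_def Hinfty_def)

lemma AE_unitary: "AE z in circle. unitary_op (\<Theta> z)"
  using inner by (simp add: inner_function_def)

lemma L2_J: "f \<in> L2 \<Longrightarrow> (\<lambda>z. J (f z)) \<in> L2"
  by (rule L2_linear[OF conjugation_bounded_linear[OF J]])

lemma J_swap: "cinner x (J y) = cinner y (J x)"
  using J by (metis conjugation_def)

lemma J_monomial: "norm z = 1 \<Longrightarrow> J (monomial n y z) = monomial (- n) (J y) z"
  by (simp add: monomial_def conjugation_scaleC[OF J] cnj_powi_unit del: complex_cnj_power_int)

lemma mult_monomial: "norm z = 1 \<Longrightarrow> \<Theta> z (monomial n y z) = z powi n *\<^sub>C \<Theta> z y"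
  by (simp add: monomial_def Linfty_scaleC[OF Linfty])

lemma mult_isometric:
  assumes "f \<in> L2" "g \<in> L2"
  shows "l2_inner (\<lambda>z. \<Theta> z (f z)) (\<lambda>z. \<Theta> z (g z)) = l2_inner f g"
proof (rule l2_inner_cong)
  show "AE z in circle. cinner (\<Theta> z (f z)) (\<Theta> z (g z)) = cinner (f z) (g z)"
    using AE_unitary by eventually_elim (rule unitary_op_isometric)
qed (use assms L2_mult[OF Linfty] in \<open>auto simp: L2_measurable\<close>)

lemma adjoint_pointwise:
  "symmetric_op J (\<Theta> z) \<Longrightarrow> cinner (\<Theta> z x) y = cinner x (J (\<Theta> z (J y)))"
  by (simp add: symmetric_op_def is_adjoint_def)

lemma mult_adjoint:
  assumes "f \<in> L2" "g \<in> L2"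
  shows "l2_inner (\<lambda>z. \<Theta> z (f z)) g = l2_inner f (\<lambda>z. J (\<Theta> z (J (g z))))"
proof (rule l2_inner_cong)
  show "AE z in circle. cinner (\<Theta> z (f z)) (g z) = cinner (f z) (J (\<Theta> z (J (g z))))"
    using sym by eventually_elim (rule adjoint_pointwise)
qed (use assms L2_mult[OF Linfty] L2_J in \<open>auto simp: L2_measurable\<close>)

lemma mult_const_H2: "(\<lambda>z. \<Theta> z x) \<in> H2"
proof -
  have "fourier_coeff (\<lambda>z. \<Theta> z x) n = 0" if "n < 0" for n
    using inner that by (auto simp: inner_function_def Hinfty_def op_fourier_coeff_def dest: fun_cong)
  then show ?thesis using L2_mult[OF Linfty L2_const] by (simp add: H2_def)
qed

lemma mult_monomial_H2:
  assumes "n \<ge> 0"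
  shows "(\<lambda>z. \<Theta> z (monomial n y z)) \<in> H2"
proof -
  have "l2_inner (\<lambda>z. \<Theta> z (monomial n y z)) (monomial m x)
      = l2_inner (\<lambda>z. z powi n *\<^sub>C \<Theta> z y) (monomial m x)" for m x
    by (auto simp: l2_inner_def mult_monomial intro!: Bochner_Integration.integral_cong)
  then show ?thesis
    using H2_powi[OF mult_const_H2 assms] L2_mult[OF Linfty L2_monomial] by (simp add: H2_iff)
qed

text \<open>The pairing of \<open>\<Theta> g\<close> with \<open>z\<^sup>n y\<close>, \<open>n < 0\<close>, equals that of \<open>g\<close> with \<open>\<Theta>\<^sup>* z\<^sup>n y\<close>. The latter function is
  orthogonal to analytic monomials because \<open>\<Theta>\<close> maps these into \<open>H\<^sup>2\<close>.\<close>

lemma mult_H2: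
  assumes "g \<in> H2"
  shows "(\<lambda>z. \<Theta> z (g z)) \<in> H2"
  unfolding H2_iff
proof (intro conjI allI impI)
  have g: "g \<in> L2" using assms by (rule H2_L2)
  show "(\<lambda>z. \<Theta> z (g z)) \<in> L2" by (rule L2_mult[OF Linfty g])
  fix n :: int and y assume "n < 0"
  define q where "q = (\<lambda>z. J (\<Theta> z (J (monomial n y z))))"
  have q: "q \<in> L2" unfolding q_def by (intro L2_J L2_mult[OF Linfty] L2_monomial)
  have "l2_inner g q = 0"
  proof (rule H2_orthogonal[OF assms q])
    fix m :: int and x assume "m \<ge> 0"
    have "l2_inner (monomial m x) q = l2_inner (\<lambda>z. \<Theta> z (monomial m x z)) (monomial n y)"
      unfolding q_def by (rule mult_adjoint[symmetric]) simp_all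
    then show "l2_inner (monomial m x) q = 0"
      using mult_monomial_H2[OF \<open>m \<ge> 0\<close>] \<open>n < 0\<close> by (simp add: H2_iff)
  qed
  then show "l2_inner (\<lambda>z. \<Theta> z (g z)) (monomial n y) = 0"
    using mult_adjoint[OF g L2_monomial] by (simp add: q_def)
qed

definition Theta0 :: "'h \<Rightarrow> 'h"
  where "Theta0 x = fourier_coeff (\<lambda>z. \<Theta> z x) 0"

definition Theta0_adj :: "'h \<Rightarrow> 'h"
  where "Theta0_adj x = J (Theta0 (J x))"

lemma cinner_Theta0: "cinner (Theta0 x) y = l2_inner (\<lambda>z. \<Theta> z x) (monomial 0 y)"
  unfolding Theta0_def by (rule cinner_fourier_coeff[OF L2_mult[OF Linfty L2_const]])

text \<open>Averaging the identity \<open>\<Theta>(z)\<^sup>* = J \<Theta>(z) J\<close> over the circle shows that \<open>\<Theta>(0)\<close> is \<open>J\<close>-symmetric too. This form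
  of the adjoint gives its norm bound at once, since \<open>J\<close> is isometric.\<close>

lemma Theta0_adjoint: "cinner (Theta0 x) y = cinner x (Theta0_adj y)"
proof -
  have "cinner x (Theta0_adj y) = cinner (Theta0 (J y)) (J x)"
    unfolding Theta0_adj_def by (rule J_swap)
  also have "\<dots> = l2_inner (\<lambda>z. \<Theta> z (J y)) (\<lambda>z. J x)"
    by (simp add: cinner_Theta0 monomial_0)
  also have "\<dots> = l2_inner (\<lambda>z. x) (\<lambda>z. J (\<Theta> z (J y)))"
    unfolding l2_inner_def by (intro Bochner_Integration.integral_cong refl J_swap)
  also have "\<dots> = l2_inner (\<lambda>z. \<Theta> z x) (\<lambda>z. y)"
    by (rule mult_adjoint[symmetric]) (rule L2_const)+
  also have "\<dots> = cinner (Theta0 x) y" by (simp add: cinner_Theta0 monomial_0)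
  finally show ?thesis ..
qed

lemma Theta0_adj_adjoint: "cinner (Theta0_adj x) y = cinner x (Theta0 y)"
  using Theta0_adjoint[of y x] by (metis cinner_commute)

lemma bounded_linear_Theta0: "bounded_linear Theta0"
  using bounded_clinear_if_adjoint[OF Theta0_adjoint] by (simp add: bounded_clinear_def)

lemma bounded_clinear_Theta0_adj: "bounded_clinear Theta0_adj"
  by (rule bounded_clinear_if_adjoint[OF Theta0_adj_adjoint])

lemma Theta0_adj_scaleC: "Theta0_adj (a *\<^sub>C x) = a *\<^sub>C Theta0_adj x"
  using bounded_clinear_Theta0_adj by (simp add: bounded_clinear_def)

lemma Theta0_contraction:
  assumes "pure_function \<Theta>"
  obtains r where "0 \<le> r" "r < 1" "\<And>x. norm (Theta0_adj x) \<le> r * norm x"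
proof
  have "disc_ext \<Theta> 0 = Theta0"
  proof
    fix x
    have "disc_ext \<Theta> 0 x = (\<Sum>n\<in>{0}. (0 ^ n) *\<^sub>C op_fourier_coeff \<Theta> (int n) x)"
      unfolding disc_ext_def by (rule suminf_finite) (auto simp: power_0_left)
    then show "disc_ext \<Theta> 0 x = Theta0 x" by (simp add: op_fourier_coeff_def Theta0_def)
  qed
  then show "onorm Theta0 < 1" using assms by (simp add: pure_function_def)
  show "0 \<le> onorm Theta0" by (rule onorm_pos_le[OF bounded_linear_Theta0])
  show "norm (Theta0_adj x) \<le> onorm Theta0 * norm x" for x
    using onorm[OF bounded_linear_Theta0, of "J x"] by (simp add: Theta0_adj_def conjugation_norm[OF J])
qed

lemma L2_Theta0_adj: "f \<in> L2 \<Longrightarrow> (\<lambda>z. Theta0_adj (f z)) \<in> L2"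
  using bounded_clinear_Theta0_adj by (rule L2_linear[OF conjunct1[OF iffD1[OF bounded_clinear_def]]])

lemma Theta0_adj_H2:
  assumes "g \<in> H2"
  shows "(\<lambda>z. Theta0_adj (g z)) \<in> H2"
proof -
  have "l2_inner (\<lambda>z. Theta0_adj (g z)) (monomial n y) = l2_inner g (monomial n (Theta0 y))" for n y
    unfolding l2_inner_def monomial_def
    by (simp add: cinner_scaleC_right Theta0_adj_adjoint)
  then show ?thesis using assms by (simp add: H2_iff L2_Theta0_adj)
qed

text \<open>These functions are the reproducing kernels of the model space at the origin. Orthogonality to
  \<open>\<Theta> g\<close> means that \<open>x\<close> and \<open>\<Theta> \<Theta>(0)\<^sup>* x\<close> have the same pairing with it, and both pairings only see the
  constant term: \<open>\<langle>\<Theta>(0) g(0), x\<rangle> = \<langle>g(0), \<Theta>(0)\<^sup>* x\<rangle>\<close>.\<close>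

lemma kernel_in_model_space: "(\<lambda>z. x - \<Theta> z (Theta0_adj x)) \<in> model_space \<Theta>"
  unfolding model_space_def mem_Collect_eq
proof (intro conjI ballI)
  define k where "k = (\<lambda>z. x - \<Theta> z (Theta0_adj x))"
  have "monomial 0 x \<in> H2" by (rule H2_monomial) simp
  then show "(\<lambda>z. x - \<Theta> z (Theta0_adj x)) \<in> H2"
    unfolding monomial_0 by (intro H2_diff mult_const_H2)
  then have k: "k \<in> L2" unfolding k_def by (rule H2_L2)
  fix g :: "complex \<Rightarrow> 'h" assume g: "g \<in> H2"
  define q where "q = (\<lambda>z. J (\<Theta> z (J (k z))))"
  have q: "q \<in> L2" unfolding q_def by (intro L2_J L2_mult[OF Linfty] k)
  have "l2_inner g q = 0"
  proof (rule H2_orthogonal[OF g q])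
    fix m :: int and y assume m: "m \<ge> 0"
    define f where "f = (\<lambda>z. \<Theta> z (monomial m y z))"
    have f: "f \<in> L2" unfolding f_def by (rule L2_mult[OF Linfty L2_monomial])
    have "l2_inner f (monomial 0 x) = l2_inner (\<lambda>z. z powi m *\<^sub>C \<Theta> z y) (monomial 0 x)"
      by (auto simp: f_def l2_inner_def mult_monomial intro!: Bochner_Integration.integral_cong)
    also have "\<dots> = l2_inner (\<lambda>z. \<Theta> z y) (monomial (- m) x)"
      by (simp add: l2_inner_powi_monomial)
    also have "\<dots> = (if m = 0 then cinner y (Theta0_adj x) else 0)"
      using m mult_const_H2[of y]
      by (auto simp: H2_iff simp flip: cinner_Theta0 Theta0_adjoint)
    also have "\<dots> = l2_inner (monomial m y) (monomial 0 (Theta0_adj x))"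
      by (simp add: l2_inner_monomials)
    also have "\<dots> = l2_inner f (\<lambda>z. \<Theta> z (Theta0_adj x))"
      unfolding f_def using mult_isometric[OF L2_monomial[of m y] L2_monomial[of 0 "Theta0_adj x"]]
      by (simp add: monomial_0)
    finally have "l2_inner f k = 0"
      unfolding k_def using f L2_mult[OF Linfty L2_const] L2_const[of x]
      by (simp add: l2_inner_diff_right monomial_0)
    moreover have "l2_inner (monomial m y) q = l2_inner f k"
      unfolding q_def f_def by (rule mult_adjoint[symmetric]) (simp_all add: k)
    ultimately show "l2_inner (monomial m y) q = 0" by simp
  qed
  then have "l2_inner (mult_op \<Theta> g) k = 0"
    using mult_adjoint[OF H2_L2[OF g] k] by (simp add: q_def mult_op_def)
  then show "l2_inner (\<lambda>z. x - \<Theta> z (Theta0_adj x)) (mult_op \<Theta> g) = 0"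
    by (subst l2_inner_zero_commute) (simp add: k_def)
qed

subsection \<open>The conjugation attached to a symmetric inner function\<close>

lemma model_conj_alt: "norm z = 1 \<Longrightarrow> model_conj \<Theta> J f z = z powi (- 1) *\<^sub>C \<Theta> z (J (f z))"
  using cnj_powi_unit[of z 1] by (simp add: model_conj_def Linfty_scaleC[OF Linfty])

lemma L2_model_conj:
  assumes "f \<in> L2"
  shows "model_conj \<Theta> J f \<in> L2"
  by (rule L2_cong[OF L2_powi[OF L2_mult[OF Linfty L2_J[OF assms]]]]) (rule model_conj_alt)

lemma model_conj_cong: "l2_eq f g \<Longrightarrow> l2_eq (model_conj \<Theta> J f) (model_conj \<Theta> J g)"
  unfolding l2_eq_def model_conj_def by (auto elim: eventually_mono)

lemma model_conj_powi:
  "l2_eq (model_conj \<Theta> J (\<lambda>z. z powi n *\<^sub>C f z)) (\<lambda>z. z powi (- n) *\<^sub>C model_conj \<Theta> J f z)"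
  by (rule l2_eq_on_circle)
    (simp add: model_conj_alt conjugation_scaleC[OF J] Linfty_scaleC[OF Linfty] cnj_powi_unit
      scaleC_scaleC mult.commute del: complex_cnj_power_int)

lemma model_conj_antiunitary:
  assumes "f \<in> L2" "g \<in> L2"
  shows "l2_inner (model_conj \<Theta> J f) (model_conj \<Theta> J g) = l2_inner g f"
proof (rule l2_inner_cong)
  show "AE z in circle. cinner (model_conj \<Theta> J f z) (model_conj \<Theta> J g z) = cinner (g z) (f z)"
    using AE_unitary AE_circle_sphere
  proof eventually_elim
    fix z assume z: "unitary_op (\<Theta> z)" "norm z = 1"
    have "z * cnj z = 1" using complex_norm_square[of z] z(2) by simp
    then show "cinner (model_conj \<Theta> J f z) (model_conj \<Theta> J g z) = cinner (g z) (f z)"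
      using J by (simp add: model_conj_def unitary_op_isometric[OF z(1)] cinner_scaleC_left
          cinner_scaleC_right conjugation_def mult.commute[of "cnj z"] flip: mult.assoc)
  qed
qed (use assms L2_model_conj in \<open>auto simp: L2_measurable\<close>)

lemma model_conj_involution: "l2_eq (model_conj \<Theta> J (model_conj \<Theta> J f)) f"
  unfolding l2_eq_def using AE_unitary sym AE_circle_sphere
proof eventually_elim
  fix z assume z: "unitary_op (\<Theta> z)" "symmetric_op J (\<Theta> z)" "norm z = 1"
  have "cnj z * z = 1" using complex_norm_square[of z] z(3) by (simp add: mult.commute)
  then show "model_conj \<Theta> J (model_conj \<Theta> J f) z = f z"
    using unitary_symmetric_involution[OF z(1,2) J, of "f z"]
    by (simp add: model_conj_def conjugation_scaleC[OF J] Linfty_scaleC[OF Linfty z(3)] scaleC_scaleC)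
qed

text \<open>The two conditions defining the model space are exchanged: \<open>J\<close>-symmetry identifies the coefficients of
  negative index of the image with pairings of \<open>f\<close> with \<open>\<Theta> H\<^sup>2\<close>, and since \<open>\<Theta>(z)\<close> is isometric, pairings
  of the image with \<open>\<Theta> g\<close> are pairings of \<open>cnj z J f\<close>, which has only coefficients of negative index,
  with \<open>g\<close>.\<close>

lemma model_conj_model_space:
  assumes "f \<in> model_space \<Theta>"
  shows "model_conj \<Theta> J f \<in> model_space \<Theta>"
proof -
  have fH: "f \<in> H2" and orth: "\<And>g. g \<in> H2 \<Longrightarrow> l2_inner f (mult_op \<Theta> g) = 0"
    using assms by (auto simp: model_space_def)
  have f: "f \<in> L2" using fH by (rule H2_L2)
  have "model_conj \<Theta> J f \<in> H2"
    unfolding H2_iff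
  proof (intro conjI allI impI)
    show "model_conj \<Theta> J f \<in> L2" by (rule L2_model_conj[OF f])
    fix n :: int and y assume n: "n < 0"
    have "l2_inner (model_conj \<Theta> J f) (monomial n y)
        = l2_inner (\<lambda>z. \<Theta> z (monomial (- n - 1) (J y) z)) f"
    proof (rule l2_inner_cong)
      show "AE z in circle. cinner (model_conj \<Theta> J f z) (monomial n y z)
          = cinner (\<Theta> z (monomial (- n - 1) (J y) z)) (f z)"
        using sym AE_circle_sphere
      proof eventually_elim
        fix z assume z: "symmetric_op J (\<Theta> z)" "norm z = 1"
        have "cinner (model_conj \<Theta> J f z) (monomial n y z)
            = z powi (- 1) * cinner (\<Theta> z (J (f z))) (monomial n y z)"
          by (simp add: model_conj_alt z cinner_scaleC_left)
        also have "cinner (\<Theta> z (J (f z))) (monomial n y z)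
            = cinner (\<Theta> z (J (monomial n y z))) (f z)"
          using adjoint_pointwise[OF z(1), of "J (f z)" "monomial n y z"]
            J_swap[of "J (f z)" "\<Theta> z (J (monomial n y z))"]
          by (simp only: conjugation_involution[OF J])
        also have "z powi (- 1) * \<dots> = cinner (\<Theta> z (monomial (- n - 1) (J y) z)) (f z)"
        proof -
          have "- n - 1 = - 1 + - n" by simp
          then have "z powi (- n - 1) = z powi (- 1) * z powi (- n)"
            by (simp only: powi_add_unit[OF z(2)])
          then show ?thesis
            by (simp only: J_monomial[OF z(2)] mult_monomial[OF z(2)] cinner_scaleC_left mult.assoc)
        qed
        finally show "cinner (model_conj \<Theta> J f z) (monomial n y z)
            = cinner (\<Theta> z (monomial (- n - 1) (J y) z)) (f z)" .
      qed
    qed (auto intro!: L2_measurable L2_model_conj f L2_mult[OF Linfty])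
    moreover have "l2_inner f (\<lambda>z. \<Theta> z (monomial (- n - 1) (J y) z)) = 0"
      using orth[OF H2_monomial[of "- n - 1" "J y"]] n by (simp add: mult_op_def)
    ultimately show "l2_inner (model_conj \<Theta> J f) (monomial n y) = 0"
      by (simp add: l2_inner_zero_commute[of _ f])
  qed
  moreover have "l2_inner (model_conj \<Theta> J f) (mult_op \<Theta> g) = 0" if g: "g \<in> H2" for g
  proof -
    define q where "q = (\<lambda>z. z powi (- 1) *\<^sub>C J (f z))"
    have q: "q \<in> L2" unfolding q_def by (intro L2_powi L2_J f)
    have "l2_inner g q = 0"
    proof (rule H2_orthogonal[OF g q])
      fix m :: int and y assume m: "m \<ge> 0"
      have "l2_inner (monomial m y) q = l2_inner f (monomial (- m - 1) (J y))"
        unfolding l2_inner_def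
      proof (intro Bochner_Integration.integral_cong refl)
        fix z :: complex assume "z \<in> space circle"
        then have z: "norm z = 1" by simp
        have "cinner (monomial m y z) (q z) = cinner (monomial (m + 1) y z) (J (f z))"
          by (simp only: q_def monomial_def cinner_scaleC_left cinner_scaleC_right powi_add_unit[OF z]
              cnj_powi_unit[OF z] minus_minus mult_ac)
        also have "\<dots> = cinner (f z) (monomial (- m - 1) (J y) z)"
        proof -
          have "- (m + 1) = - m - 1" by simp
          then show ?thesis by (simp only: J_swap[of "monomial (m + 1) y z"] J_monomial[OF z])
        qed
        finally show "cinner (monomial m y z) (q z) = cinner (f z) (monomial (- m - 1) (J y) z)" .
      qed
      then show "l2_inner (monomial m y) q = 0" using fH m by (simp add: H2_iff)
    qed
    moreover have "l2_inner (model_conj \<Theta> J f) (mult_op \<Theta> g)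
        = l2_inner (\<lambda>z. \<Theta> z (q z)) (\<lambda>z. \<Theta> z (g z))"
      unfolding l2_inner_def mult_op_def
      by (intro Bochner_Integration.integral_cong)
        (auto simp: model_conj_alt q_def Linfty_scaleC[OF Linfty])
    ultimately show ?thesis
      using mult_isometric[OF q H2_L2[OF g]] by (simp add: l2_inner_zero_commute[of q])
  qed
  ultimately show ?thesis by (simp add: model_space_def)
qed

end

section \<open>Operators commuting with multiplication by \<open>z\<close>\<close>

text \<open>Operators act on representatives, so commutation holds only almost everywhere. All \<open>n\<close> are included,
  positive and negative. Linearity is a consequence of having an adjoint.\<close>

definition shift_commuting_adjoints ::
    "((complex \<Rightarrow> 'h::fd_complex_hilbert) \<Rightarrow> complex \<Rightarrow> 'h) \<Rightarrow> ((complex \<Rightarrow> 'h) \<Rightarrow> complex \<Rightarrow> 'h) \<Rightarrow> bool"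
  where "shift_commuting_adjoints D E \<longleftrightarrow>
    (\<forall>f\<in>L2. D f \<in> L2) \<and> (\<forall>f\<in>L2. E f \<in> L2) \<and>
    (\<forall>f\<in>L2. \<forall>g\<in>L2. l2_inner (D f) g = l2_inner f (E g)) \<and>
    (\<forall>f\<in>L2. \<forall>n. l2_eq (D (\<lambda>z. z powi n *\<^sub>C f z)) (\<lambda>z. z powi n *\<^sub>C D f z)) \<and>
    (\<forall>f\<in>L2. \<forall>n. l2_eq (E (\<lambda>z. z powi n *\<^sub>C f z)) (\<lambda>z. z powi n *\<^sub>C E f z))"

lemma shift_commuting_adjoints_sym:
  assumes "shift_commuting_adjoints D E"
  shows "shift_commuting_adjoints E D"
proof -
  have "l2_inner (E f) g = l2_inner f (D g)" if "f \<in> L2" "g \<in> L2" for f g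
    using assms that l2_inner_commute[of "E f" g] l2_inner_commute[of f "D g"]
    by (simp add: shift_commuting_adjoints_def)
  then show ?thesis using assms by (simp add: shift_commuting_adjoints_def)
qed

context
  fixes D E :: "(complex \<Rightarrow> 'h::fd_complex_hilbert) \<Rightarrow> complex \<Rightarrow> 'h"
  assumes DE: "shift_commuting_adjoints D E"
begin

lemma shift_commuting_L2: "f \<in> L2 \<Longrightarrow> D f \<in> L2" "f \<in> L2 \<Longrightarrow> E f \<in> L2"
  using DE by (auto simp: shift_commuting_adjoints_def)

lemma shift_commuting_adjoint: "f \<in> L2 \<Longrightarrow> g \<in> L2 \<Longrightarrow> l2_inner (D f) g = l2_inner f (E g)"
  using DE by (auto simp: shift_commuting_adjoints_def)

lemma shift_commuting_monomial:
  assumes "f \<in> L2"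
  shows "l2_inner (D (\<lambda>z. z powi m *\<^sub>C f z)) (monomial n y) = l2_inner (D f) (monomial (n - m) y)"
proof -
  have "l2_inner (D (\<lambda>z. z powi m *\<^sub>C f z)) (monomial n y) = l2_inner (\<lambda>z. z powi m *\<^sub>C D f z) (monomial n y)"
  proof (rule l2_inner_eq)
    show "l2_eq (D (\<lambda>z. z powi m *\<^sub>C f z)) (\<lambda>z. z powi m *\<^sub>C D f z)"
      using DE assms by (simp add: shift_commuting_adjoints_def)
  qed (simp_all add: assms shift_commuting_L2 L2_powi)
  then show ?thesis by (simp add: l2_inner_powi_monomial)
qed

end

text \<open>Pairing with an adjoint image of a negative power of \<open>z\<close> cannot distinguish \<open>g \<in> H\<^sup>2\<close> from
  \<open>\<Theta> \<Theta>(0)\<^sup>* g\<close>, because \<open>D\<close> maps the functions \<open>z\<^sup>m (1 - \<Theta> \<Theta>(0)\<^sup>*) x\<close> into \<open>H\<^sup>2\<close>; iterating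
  this, purity of \<open>\<Theta>\<close> makes the pairing vanish.\<close>

lemma (in symmetric_inner) const_to_H2:
  assumes pure: "pure_function \<Theta>" and DE: "shift_commuting_adjoints D E"
    and K: "\<And>f. f \<in> model_space \<Theta> \<Longrightarrow> D f \<in> model_space \<Theta>"
  shows "D (monomial 0 x) \<in> H2"
  unfolding H2_iff
proof (intro conjI allI impI)
  show "D (monomial 0 x) \<in> L2" by (rule shift_commuting_L2(1)[OF DE L2_monomial])
  fix n :: int and y assume n: "n < 0"
  define u where "u = E (monomial n y)"
  have u: "u \<in> L2" unfolding u_def by (rule shift_commuting_L2(2)[OF DE L2_monomial])
  define T where "T g = (\<lambda>z. \<Theta> z (Theta0_adj (g z)))" for g :: "complex \<Rightarrow> 'h"
  have T_L2: "T g \<in> L2" if "g \<in> L2" for g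
    unfolding T_def by (intro L2_mult[OF Linfty] L2_Theta0_adj that)
  \<comment> \<open>\<open>q = (1 - T)\<^sup>* u\<close>\<close>
  define q where "q = (\<lambda>z. u z - Theta0 (J (\<Theta> z (J (u z)))))"
  have v: "(\<lambda>z. J (\<Theta> z (J (u z)))) \<in> L2" by (intro L2_J L2_mult[OF Linfty] u)
  have w: "(\<lambda>z. Theta0 (J (\<Theta> z (J (u z))))) \<in> L2"
    by (rule L2_linear[OF bounded_linear_Theta0 v])
  have q: "q \<in> L2" unfolding q_def by (rule L2_diff[OF u w])
  have pair: "l2_inner g q = l2_inner g u - l2_inner (T g) u" if g: "g \<in> L2" for g
  proof -
    have "l2_inner (T g) u = l2_inner (\<lambda>z. Theta0_adj (g z)) (\<lambda>z. J (\<Theta> z (J (u z))))"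
      unfolding T_def by (rule mult_adjoint[OF L2_Theta0_adj[OF g] u])
    also have "\<dots> = l2_inner g (\<lambda>z. Theta0 (J (\<Theta> z (J (u z)))))"
      unfolding l2_inner_def by (intro Bochner_Integration.integral_cong refl Theta0_adj_adjoint)
    finally show ?thesis unfolding q_def by (simp add: l2_inner_diff_right[OF u w g])
  qed
  have T_inv: "l2_inner g u = l2_inner (T g) u" if g: "g \<in> H2" for g
  proof -
    have "l2_inner g q = 0"
    proof (rule H2_orthogonal[OF g q])
      fix m :: int and a assume m: "m \<ge> 0"
      define k where "k = (\<lambda>z. a - \<Theta> z (Theta0_adj a))"
      have kK: "k \<in> model_space \<Theta>" unfolding k_def by (rule kernel_in_model_space)
      then have k: "k \<in> L2" by (simp add: model_space_def H2_L2)
      have "l2_inner (monomial m a) q = l2_inner (\<lambda>z. monomial m a z - T (monomial m a) z) u"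
        by (simp add: pair l2_inner_diff_left T_L2 u)
      also have "\<dots> = l2_inner (\<lambda>z. z powi m *\<^sub>C k z) u"
        unfolding l2_inner_def
      proof (intro Bochner_Integration.integral_cong refl)
        fix z :: complex assume "z \<in> space circle"
        then have "norm z = 1" by simp
        then have "monomial m a z - T (monomial m a) z = z powi m *\<^sub>C k z"
          by (simp add: T_def k_def monomial_def Theta0_adj_scaleC Linfty_scaleC[OF Linfty] scaleC_diff_right)
        then show "cinner (monomial m a z - T (monomial m a) z) (u z) = cinner (z powi m *\<^sub>C k z) (u z)"
          by simp
      qed
      also have "\<dots> = l2_inner (D (\<lambda>z. z powi m *\<^sub>C k z)) (monomial n y)"
        unfolding u_def by (rule shift_commuting_adjoint[OF DE, symmetric]) (simp_all add: L2_powi k)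
      also have "\<dots> = l2_inner (D k) (monomial (n - m) y)"
        by (rule shift_commuting_monomial[OF DE k])
      also have "\<dots> = 0"
        using K[OF kK] n m by (simp add: model_space_def H2_iff)
      finally show "l2_inner (monomial m a) q = 0" .
    qed
    then show ?thesis using pair[OF H2_L2[OF g]] by simp
  qed
  have T_H2: "T g \<in> H2" if g: "g \<in> H2" for g
    unfolding T_def by (rule mult_H2[OF Theta0_adj_H2[OF g]])
  obtain r where r: "0 \<le> r" "r < 1" "\<And>x. norm (Theta0_adj x) \<le> r * norm x"
    by (rule Theta0_contraction[OF pure]) blast
  define f where "f k = (T ^^ k) (monomial 0 x)" for k
  have f_H2: "f k \<in> H2" for k
    by (induction k) (simp_all add: f_def H2_monomial T_H2)
  have f_pair: "l2_inner (monomial 0 x) u = l2_inner (f k) u" for k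
  proof (induction k)
    case (Suc k)
    then show ?case using T_inv[OF f_H2[of k]] by (simp add: f_def)
  qed (simp add: f_def)
  have f_norm: "AE z in circle. norm (f k z) \<le> r ^ k * norm x" for k
  proof (induction k)
    case 0
    then show ?case by (simp add: f_def monomial_0)
  next
    case (Suc k)
    show ?case
      using Suc AE_unitary
    proof eventually_elim
      fix z assume z: "norm (f k z) \<le> r ^ k * norm x" "unitary_op (\<Theta> z)"
      have "norm (f (Suc k) z) = norm (Theta0_adj (f k z))"
        by (simp add: f_def T_def unitary_op_norm[OF z(2)])
      also have "\<dots> \<le> r * norm (f k z)" by (rule r(3))
      also have "\<dots> \<le> r * (r ^ k * norm x)" using r(1) z(1) by (rule mult_left_mono[rotated])
      finally show "norm (f (Suc k) z) \<le> r ^ Suc k * norm x" by (simp add: mult.assoc)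
    qed
  qed
  define M where "M = (LINT z|circle. norm (u z))"
  have bound: "cmod (l2_inner (monomial 0 x) u) \<le> r ^ k * (norm x * M)" for k
  proof -
    have "cmod (l2_inner (monomial 0 x) u) \<le> (LINT z|circle. cmod (cinner (f k z) (u z)))"
      by (subst f_pair[of k], unfold l2_inner_def) (rule integral_norm_bound)
    also have "\<dots> \<le> (LINT z|circle. r ^ k * norm x * norm (u z))"
    proof (rule integral_mono_AE)
      show "integrable circle (\<lambda>z. cmod (cinner (f k z) (u z)))"
        by (rule integrable_norm[OF L2_integrable_cinner[OF H2_L2[OF f_H2] u]])
      show "integrable circle (\<lambda>z. r ^ k * norm x * norm (u z))"
        by (intro integrable_mult_right integrable_norm L2_integrable_self u)
      show "AE z in circle. cmod (cinner (f k z) (u z)) \<le> r ^ k * norm x * norm (u z)"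
        using f_norm[of k]
      proof eventually_elim
        fix z assume "norm (f k z) \<le> r ^ k * norm x"
        then have "norm (f k z) * norm (u z) \<le> r ^ k * norm x * norm (u z)"
          by (rule mult_right_mono) simp
        then show "cmod (cinner (f k z) (u z)) \<le> r ^ k * norm x * norm (u z)"
          using norm_cinner_le[of "f k z" "u z"] by linarith
      qed
    qed
    also have "\<dots> = r ^ k * (norm x * M)" by (simp add: M_def mult.assoc)
    finally show ?thesis .
  qed
  have lim: "(\<lambda>k. r ^ k * (norm x * M)) \<longlonglongrightarrow> 0 * (norm x * M)"
    using r by (intro tendsto_mult_right LIMSEQ_power_zero) simp
  have "cmod (l2_inner (monomial 0 x) u) \<le> 0 * (norm x * M)"
    by (rule LIMSEQ_le_const[OF lim]) (intro exI[of _ 0] allI impI bound)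
  then have "l2_inner (monomial 0 x) u = 0" by simp
  then show "l2_inner (D (monomial 0 x)) (monomial n y) = 0"
    unfolding u_def by (simp add: shift_commuting_adjoint[OF DE])
qed

definition const_symbol :: "((complex \<Rightarrow> 'h) \<Rightarrow> complex \<Rightarrow> 'h) \<Rightarrow> 'h \<Rightarrow> 'h::fd_complex_hilbert"
  where "const_symbol D x = fourier_coeff (D (monomial 0 x)) 0"

text \<open>The coefficients of \<open>D x\<close> of positive index are conjugates of coefficients of \<open>E y\<close> of negative
  index, so all coefficients but the one of index 0 vanish.\<close>

lemma const_to_const:
  assumes DE: "shift_commuting_adjoints D E"
    and D: "\<And>x. D (monomial 0 x) \<in> H2" and E: "\<And>x. E (monomial 0 x) \<in> H2"
  shows "l2_eq (D (monomial 0 x)) (monomial 0 (const_symbol D x))"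
proof (rule L2_eq_if_inner_eq)
  note ED = shift_commuting_adjoints_sym[OF DE]
  show L2: "D (monomial 0 x) \<in> L2" using D by (rule H2_L2)
  fix n y
  show "l2_inner (D (monomial 0 x)) (monomial n y) = l2_inner (monomial 0 (const_symbol D x)) (monomial n y)"
  proof (cases n "0 :: int" rule: linorder_cases)
    case less
    then show ?thesis using D[of x] by (simp add: H2_iff l2_inner_monomials)
  next
    case equal
    then show ?thesis
      using cinner_fourier_coeff[OF L2, of 0 y] by (simp add: l2_inner_monomials const_symbol_def)
  next
    case greater
    have "l2_inner (D (monomial 0 x)) (monomial n y) = cnj (l2_inner (E (monomial n y)) (monomial 0 x))"
      using shift_commuting_adjoint[OF DE L2_monomial L2_monomial] l2_inner_commute by metis
    also have "E (monomial n y) = E (\<lambda>z. z powi n *\<^sub>C monomial 0 y z)"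
      by (simp add: monomial_def)
    also have "l2_inner \<dots> (monomial 0 x) = l2_inner (E (monomial 0 y)) (monomial (0 - n) x)"
      by (rule shift_commuting_monomial[OF ED L2_monomial])
    also have "\<dots> = 0" using E[of y] greater by (simp add: H2_iff)
    finally show ?thesis using greater by (simp add: l2_inner_monomials)
  qed
qed simp

lemma const_symbol_adjoint:
  assumes DE: "shift_commuting_adjoints D E"
  shows "cinner (const_symbol D x) y = cinner x (const_symbol E y)"
proof -
  note ED = shift_commuting_adjoints_sym[OF DE]
  have "cinner (const_symbol D x) y = l2_inner (D (monomial 0 x)) (monomial 0 y)"
    unfolding const_symbol_def by (rule cinner_fourier_coeff[OF shift_commuting_L2(1)[OF DE L2_monomial]])
  also have "\<dots> = l2_inner (monomial 0 x) (E (monomial 0 y))"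
    by (rule shift_commuting_adjoint[OF DE L2_monomial L2_monomial])
  also have "\<dots> = cnj (l2_inner (E (monomial 0 y)) (monomial 0 x))" by (rule l2_inner_commute)
  also have "\<dots> = cnj (cinner (const_symbol E y) x)"
    unfolding const_symbol_def by (simp add: cinner_fourier_coeff[OF shift_commuting_L2(1)[OF ED L2_monomial]])
  finally show ?thesis by (simp flip: cinner_commute)
qed

text \<open>\<open>E\<close> maps \<open>z\<^sup>n y\<close> to \<open>z\<^sup>n\<close> times a constant, and moving \<open>D\<close> to the other side computes all Fourier
  coefficients of \<open>D f\<close>.\<close>

lemma eq_mult_const_symbol:
  assumes DE: "shift_commuting_adjoints D E"
    and D: "\<And>x. D (monomial 0 x) \<in> H2" and E: "\<And>x. E (monomial 0 x) \<in> H2" and f: "f \<in> L2"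
  shows "l2_eq (D f) (\<lambda>z. const_symbol D (f z))"
proof (rule L2_eq_if_inner_eq)
  note ED = shift_commuting_adjoints_sym[OF DE]
  show "D f \<in> L2" by (rule shift_commuting_L2(1)[OF DE f])
  have "bounded_clinear (const_symbol D)"
    by (rule bounded_clinear_if_adjoint[OF const_symbol_adjoint[OF DE]])
  then show L2: "(\<lambda>z. const_symbol D (f z)) \<in> L2"
    by (intro L2_linear[OF _ f]) (simp add: bounded_clinear_def)
  fix n y
  have "l2_eq (E (monomial n y)) (monomial n (const_symbol E y))"
  proof -
    have "l2_eq (E (\<lambda>z. z powi n *\<^sub>C monomial 0 y z)) (\<lambda>z. z powi n *\<^sub>C E (monomial 0 y) z)"
      using ED L2_monomial unfolding shift_commuting_adjoints_def by blast
    moreover have "l2_eq (\<lambda>z. z powi n *\<^sub>C E (monomial 0 y) z) (monomial n (const_symbol E y))"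
      using const_to_const[OF ED E D, of y] unfolding l2_eq_def
      by eventually_elim (simp add: monomial_def)
    ultimately show ?thesis using l2_eq_trans by (fastforce simp: monomial_def)
  qed
  then have "l2_inner f (E (monomial n y)) = l2_inner f (monomial n (const_symbol E y))"
    by (intro l2_inner_eq) (simp_all add: f shift_commuting_L2(2)[OF DE])
  also have "\<dots> = l2_inner (\<lambda>z. const_symbol D (f z)) (monomial n y)"
    unfolding l2_inner_def monomial_def
    by (simp add: cinner_scaleC_right const_symbol_adjoint[OF DE])
  finally show "l2_inner (D f) (monomial n y) = l2_inner (\<lambda>z. const_symbol D (f z)) (monomial n y)"
    by (simp add: shift_commuting_adjoint[OF DE f])
qed

lemma const_symbol_inverse:
  assumes DE: "shift_commuting_adjoints D E"
    and D: "\<And>x. D (monomial 0 x) \<in> H2" and E: "\<And>x. E (monomial 0 x) \<in> H2"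
    and inv: "\<And>f. f \<in> L2 \<Longrightarrow> l2_eq (D (E f)) f"
  shows "const_symbol D (const_symbol E x) = x"
proof -
  have "l2_eq (D (E (monomial 0 x))) (\<lambda>z. const_symbol D (E (monomial 0 x) z))"
    by (rule eq_mult_const_symbol[OF DE D E shift_commuting_L2(2)[OF DE L2_monomial]])
  moreover have "l2_eq (\<lambda>z. const_symbol D (E (monomial 0 x) z)) (\<lambda>z. const_symbol D (const_symbol E x))"
    using const_to_const[OF shift_commuting_adjoints_sym[OF DE] E D, of x] unfolding l2_eq_def
    by eventually_elim (simp add: monomial_0)
  ultimately have "l2_eq (\<lambda>z. const_symbol D (const_symbol E x)) (\<lambda>z. x)"
    using inv[OF L2_monomial[of 0 x]] l2_eq_trans l2_eq_sym unfolding monomial_0 by meson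
  then show ?thesis by (rule l2_eq_const)
qed

section \<open>Conjugations on \<open>L\<^sup>2\<close>\<close>

lemma antiunitary_swap:
  assumes "\<And>f. f \<in> L2 \<Longrightarrow> A f \<in> L2" "\<And>f. f \<in> L2 \<Longrightarrow> l2_eq (A (A f)) f"
    and "\<And>f g. f \<in> L2 \<Longrightarrow> g \<in> L2 \<Longrightarrow> l2_inner (A f) (A g) = l2_inner g f"
    and "f \<in> L2" "g \<in> L2"
  shows "l2_inner (A f) g = l2_inner (A g) f"
proof -
  have "l2_inner (A f) g = l2_inner (A f) (A (A g))"
    by (rule l2_inner_eq) (simp_all add: assms l2_eq_sym)
  also have "\<dots> = l2_inner (A g) f" by (simp add: assms)
  finally show ?thesis .
qed

text \<open>For \<open>n \<ge> 0\<close> this iterates the hypothesis; for \<open>n < 0\<close> it is the case \<open>- n\<close> applied to \<open>z\<^sup>n f\<close>.\<close>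

lemma conjugation_shift:
  assumes map: "l2_map C" and shift: "\<And>f. f \<in> L2 \<Longrightarrow> l2_eq (C (Mz f)) (Mzbar (C f))" and f: "f \<in> L2"
  shows "l2_eq (C (\<lambda>z. z powi n *\<^sub>C f z)) (\<lambda>z. z powi (- n) *\<^sub>C C f z)"
proof -
  have C: "C f \<in> L2" if "f \<in> L2" for f using map that by (simp add: l2_map_def)
  have cong: "l2_eq (C f) (C g)" if "f \<in> L2" "g \<in> L2" "l2_eq f g" for f g
    using map that unfolding l2_map_def by blast
  have mul: "l2_eq (\<lambda>z. z powi m *\<^sub>C f z) (\<lambda>z. z powi m *\<^sub>C g z)" if "l2_eq f g" for f g m
    using that unfolding l2_eq_def by eventually_elim simp
  have add: "l2_eq (\<lambda>z. z powi (k + l) *\<^sub>C f z) (\<lambda>z. z powi k *\<^sub>C z powi l *\<^sub>C f z)" for f k l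
    by (rule l2_eq_on_circle) (simp only: scaleC_scaleC powi_add_unit)
  have nonneg: "l2_eq (C (\<lambda>z. z powi (int m) *\<^sub>C f z)) (\<lambda>z. z powi (- int m) *\<^sub>C C f z)"
    if f: "f \<in> L2" for m f
  proof (induction m)
    case (Suc m)
    define g where "g = (\<lambda>z. z powi (int m) *\<^sub>C f z)"
    have g: "g \<in> L2" unfolding g_def by (rule L2_powi[OF f])
    have "l2_eq (\<lambda>z. z powi (int (Suc m)) *\<^sub>C f z) (Mz g)"
      using add[of 1 "int m" f] by (simp add: Mz_def g_def)
    then have "l2_eq (C (\<lambda>z. z powi (int (Suc m)) *\<^sub>C f z)) (C (Mz g))"
      using L2_powi[OF g, of 1] by (intro cong L2_powi f) (simp_all add: Mz_def)
    also have "l2_eq (C (Mz g)) (Mzbar (C g))" by (rule shift[OF g])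
    also have "l2_eq (Mzbar (C g)) (\<lambda>z. z powi (- 1) *\<^sub>C C g z)"
      using cnj_powi_unit[of _ 1] by (intro l2_eq_on_circle) (simp add: Mzbar_def)
    also have "l2_eq (\<lambda>z. z powi (- 1) *\<^sub>C C g z) (\<lambda>z. z powi (- 1) *\<^sub>C z powi (- int m) *\<^sub>C C f z)"
      using Suc unfolding g_def by (rule mul)
    also have "l2_eq \<dots> (\<lambda>z. z powi (- 1 + - int m) *\<^sub>C C f z)"
      by (rule l2_eq_sym[OF add])
    finally show ?case by simp
  qed simp
  show ?thesis
  proof (cases "n \<ge> 0")
    case True
    then show ?thesis using nonneg[OF f, of "nat n"] by simp
  next
    case False
    define g where "g = (\<lambda>z. z powi n *\<^sub>C f z)"
    have g: "g \<in> L2" unfolding g_def by (rule L2_powi[OF f])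
    have "l2_eq (\<lambda>z. z powi (- n) *\<^sub>C g z) f"
      unfolding g_def using l2_eq_sym[OF add[of "- n" n f]] by simp
    then have "l2_eq (C f) (C (\<lambda>z. z powi (- n) *\<^sub>C g z))"
      by (intro cong f L2_powi g) (rule l2_eq_sym)
    also have "l2_eq \<dots> (\<lambda>z. z powi n *\<^sub>C C g z)"
      using nonneg[OF g, of "nat (- n)"] False by simp
    finally have "l2_eq (\<lambda>z. z powi (- n) *\<^sub>C C f z) (\<lambda>z. z powi (- n) *\<^sub>C z powi n *\<^sub>C C g z)"
      by (rule mul)
    also have "l2_eq \<dots> (C g)"
      using l2_eq_sym[OF add[of "- n" n "C g"]] by simp
    finally show ?thesis unfolding g_def by (rule l2_eq_sym)
  qed
qed

theorem theorem6p6: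
  fixes C :: "(complex \<Rightarrow> 'h::fd_complex_hilbert) \<Rightarrow> (complex \<Rightarrow> 'h)"
    and \<Theta> :: "complex \<Rightarrow> 'h \<Rightarrow> 'h"
    and J :: "'h \<Rightarrow> 'h"
  assumes "l2_conjugation C"
    and "\<And>f. f \<in> L2 \<Longrightarrow> l2_eq (C (Mz f)) (Mzbar (C f))"
    and "\<Theta> \<in> Linfty"
    and "inner_function \<Theta>"
    and "pure_function \<Theta>"
    and "conjugation J"
    and "AE z in circle. symmetric_op J (\<Theta> z)"
    and "\<And>f. f \<in> model_space \<Theta> \<Longrightarrow> C f \<in> model_space \<Theta>"
  shows "\<exists>V V0. V \<in> Linfty \<and> (AE z in circle. unitary_op (V z)) \<and> (AE z in circle. V z = V0) \<and>
    (\<forall>f\<in>L2. l2_eq (C f) (mult_op V (model_conj \<Theta> J f))) \<and>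
    l2_symmetric (model_conj \<Theta> J) (mult_op V)"
proof -
  interpret symmetric_inner \<Theta> J
    by unfold_locales (rule assms)+
  have map: "l2_map C" using assms(1) by (simp add: l2_conjugation_def)
  have C: "C f \<in> L2" if "f \<in> L2" for f using map that by (simp add: l2_map_def)
  have C_cong: "l2_eq (C f) (C g)" if "f \<in> L2" "g \<in> L2" "l2_eq f g" for f g
    using map that unfolding l2_map_def by blast
  have C_inv: "l2_eq (C (C f)) f" if "f \<in> L2" for f
    using assms(1) that by (simp add: l2_conjugation_def)
  have C_anti: "l2_inner (C f) (C g) = l2_inner g f" if "f \<in> L2" "g \<in> L2" for f g
    using assms(1) that by (simp add: l2_conjugation_def)
  have C_swap: "l2_inner (C f) g = l2_inner (C g) f" if "f \<in> L2" "g \<in> L2" for f g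
    by (rule antiunitary_swap[OF C C_inv C_anti that])
  have C_shift: "l2_eq (C (\<lambda>z. z powi n *\<^sub>C f z)) (\<lambda>z. z powi (- n) *\<^sub>C C f z)" if "f \<in> L2" for f n
    by (rule conjugation_shift[OF map assms(2) that])
  define S where "S = model_conj \<Theta> J"
  have S: "S f \<in> L2" if "f \<in> L2" for f unfolding S_def by (rule L2_model_conj[OF that])
  have S_cong: "l2_eq (S f) (S g)" if "l2_eq f g" for f g
    unfolding S_def by (rule model_conj_cong[OF that])
  have S_inv: "l2_eq (S (S f)) f" for f unfolding S_def by (rule model_conj_involution)
  have S_swap: "l2_inner (S f) g = l2_inner (S g) f" if "f \<in> L2" "g \<in> L2" for f g
    unfolding S_def
    by (rule antiunitary_swap[OF L2_model_conj model_conj_involution model_conj_antiunitary that])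
  have S_shift: "l2_eq (S (\<lambda>z. z powi n *\<^sub>C f z)) (\<lambda>z. z powi (- n) *\<^sub>C S f z)" for f n
    unfolding S_def by (rule model_conj_powi)
  define D where "D f = C (S f)" for f
  define E where "E f = S (C f)" for f
  have DE: "shift_commuting_adjoints D E"
    unfolding shift_commuting_adjoints_def
  proof (intro conjI ballI allI)
    fix f :: "complex \<Rightarrow> 'h" assume f: "f \<in> L2"
    show "D f \<in> L2" "E f \<in> L2" unfolding D_def E_def by (intro C S f)+
    show "l2_inner (D f) g = l2_inner f (E g)" if g: "g \<in> L2" for g
    proof -
      have "l2_inner (D f) g = l2_inner (C g) (S f)"
        unfolding D_def by (rule C_swap[OF S[OF f] g])
      also have "\<dots> = cnj (l2_inner (S f) (C g))" by (rule l2_inner_commute)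
      also have "\<dots> = cnj (l2_inner (S (C g)) f)" using S_swap[OF f C[OF g]] by simp
      also have "\<dots> = l2_inner f (E g)" unfolding E_def by (rule l2_inner_commute[symmetric])
      finally show ?thesis .
    qed
    fix n :: int
    have "l2_eq (D (\<lambda>z. z powi n *\<^sub>C f z)) (C (\<lambda>z. z powi (- n) *\<^sub>C S f z))"
      unfolding D_def by (intro C_cong S_shift S L2_powi f)
    also have "l2_eq \<dots> (\<lambda>z. z powi (- (- n)) *\<^sub>C C (S f) z)"
      by (rule C_shift[OF S[OF f]])
    finally show "l2_eq (D (\<lambda>z. z powi n *\<^sub>C f z)) (\<lambda>z. z powi n *\<^sub>C D f z)"
      by (simp add: D_def)
    have "l2_eq (E (\<lambda>z. z powi n *\<^sub>C f z)) (S (\<lambda>z. z powi (- n) *\<^sub>C C f z))"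
      unfolding E_def by (intro S_cong C_shift[OF f])
    also have "l2_eq \<dots> (\<lambda>z. z powi (- (- n)) *\<^sub>C S (C f) z)" by (rule S_shift)
    finally show "l2_eq (E (\<lambda>z. z powi n *\<^sub>C f z)) (\<lambda>z. z powi n *\<^sub>C E f z)"
      by (simp add: E_def)
  qed
  note ED = shift_commuting_adjoints_sym[OF DE]
  have D_H2: "D (monomial 0 x) \<in> H2" for x
    by (rule const_to_H2[OF assms(5) DE]) (simp add: D_def S_def assms(8) model_conj_model_space)
  have E_H2: "E (monomial 0 x) \<in> H2" for x
    by (rule const_to_H2[OF assms(5) ED]) (simp add: E_def S_def assms(8) model_conj_model_space)
  have DE_id: "l2_eq (D (E f)) f" if f: "f \<in> L2" for f
    unfolding D_def E_def using C_cong[OF S[OF S[OF C[OF f]]] C[OF f] S_inv] C_inv[OF f] by (rule l2_eq_trans)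
  have ED_id: "l2_eq (E (D f)) f" if f: "f \<in> L2" for f
    unfolding D_def E_def using S_cong[OF C_inv[OF S[OF f]]] S_inv by (rule l2_eq_trans)
  define V0 where "V0 = const_symbol D"
  define V where "V = (\<lambda>z::complex. V0)"
  have D_eq: "l2_eq (D f) (mult_op V f)" if "f \<in> L2" for f
    using eq_mult_const_symbol[OF DE D_H2 E_H2 that] by (simp add: mult_op_def V_def V0_def)
  have clin: "bounded_clinear V0"
    unfolding V0_def by (rule bounded_clinear_if_adjoint[OF const_symbol_adjoint[OF DE]])
  have unitary: "unitary_op V0"
    unfolding unitary_op_def
  proof (intro conjI exI[of _ "const_symbol E"] clin)
    show "is_adjoint V0 (const_symbol E)"
      by (simp add: is_adjoint_def V0_def const_symbol_adjoint[OF DE])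
    show "const_symbol E \<circ> V0 = id"
      using const_symbol_inverse[OF ED E_H2 D_H2 ED_id] by (simp add: V0_def fun_eq_iff)
    show "V0 \<circ> const_symbol E = id"
      using const_symbol_inverse[OF DE D_H2 E_H2 DE_id] by (simp add: V0_def fun_eq_iff)
  qed
  have V: "V \<in> Linfty"
    using clin by (auto simp: Linfty_def V_def intro!: exI[of _ "onorm V0"])
  have V_L2: "mult_op V f \<in> L2" if "f \<in> L2" for f
    unfolding mult_op_def by (rule L2_mult[OF V that])
  have C_eq: "l2_eq (C f) (mult_op V (S f))" if f: "f \<in> L2" for f
  proof -
    have "l2_eq (C f) (D (S f))"
      unfolding D_def by (intro C_cong f S l2_eq_sym[OF S_inv])
    then show ?thesis using D_eq[OF S[OF f]] by (rule l2_eq_trans)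
  qed
  have "l2_symmetric S (mult_op V)"
    unfolding l2_symmetric_def l2_bounded_clinear_def
  proof (intro conjI ballI allI)
    show "l2_map (mult_op V)"
      unfolding l2_map_def
    proof (intro conjI ballI impI)
      show "l2_eq (mult_op V f) (mult_op V g)" if "l2_eq f g" for f g :: "complex \<Rightarrow> 'h"
        using that unfolding l2_eq_def mult_op_def V_def by eventually_elim simp
    qed (rule V_L2)
    fix f g :: "complex \<Rightarrow> 'h"
    show "l2_eq (mult_op V (\<lambda>z. f z + g z)) (\<lambda>z. mult_op V f z + mult_op V g z)"
      using clin by (simp add: mult_op_def V_def bounded_clinear_def bounded_linear.linear linear_add)
    show "l2_eq (mult_op V (\<lambda>z. a *\<^sub>C f z)) (\<lambda>z. a *\<^sub>C mult_op V f z)" for a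
      using clin by (simp add: mult_op_def V_def bounded_clinear_def)
    show "\<exists>K. \<forall>f\<in>L2. l2_norm (mult_op V f) \<le> K * l2_norm f"
      by (rule exI[of _ 1]) (simp add: l2_norm_def mult_op_def V_def unitary_op_norm[OF unitary])
    assume f: "f \<in> L2" and g: "g \<in> L2"
    have "l2_inner (mult_op V f) g = l2_inner (D f) g"
      by (rule l2_inner_eq) (simp_all add: l2_eq_sym[OF D_eq] V_L2 shift_commuting_L2[OF DE] f g)
    also have "\<dots> = l2_inner f (S (C g))" using shift_commuting_adjoint[OF DE f g] by (simp add: E_def)
    also have "\<dots> = l2_inner f (S (mult_op V (S g)))"
      by (rule l2_inner_eq) (simp_all add: S_cong C_eq S C V_L2 f g)
    finally show "l2_inner (mult_op V f) g = l2_inner f (S (mult_op V (S g)))" .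
  qed
  then show ?thesis
    using V unitary C_eq unfolding S_def
    by (intro exI[of _ V] exI[of _ V0]) (simp add: V_def)
qed

end
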